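(* Let $q > r \ge 1$ be integers. If $L$ is a $K_q^r$-divisible $r$-graph, then there exists a $K_q^r$-absorber for $L$.
   Context: An $r$-graph is identified with its edge set; $V(G)$ denotes the vertex set of an $r$-graph $G$. $K_q^r$ is the complete $r$-graph on $q$ vertices. For an $r$-graph $F$, an $F$-decomposition of an $r$-graph $G$ is a partition of the edge set of $G$ into copies of $F$. An $r$-graph $G$ is $K_q^r$-divisible if $\binom{q-i}{r-i}$ divides $|\{e \in G : S \subseteq e\}|$ for every $0 \le i \le r-1$ and every $S \subseteq V(G)$ with $|S| = i$. A set $X$ of vertices is independent in an $r$-graph $A$ if no edge of $A$ is contained in $X$. For a $K_q^r$-divisible $r$-graph $L$, an $r$-graph $A$ is a $K_q^r$-absorber for $L$ if $V(L) \subseteq V(A)$, $V(L)$ is independent in $A$, and both $A$ and $L \cup A$ admit $K_q^r$-decompositions. *)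

theory Defs
  imports Main
begin

definition rgraph :: "nat \<Rightarrow> 'a set \<Rightarrow> 'a set set \<Rightarrow> bool" where
  "rgraph r V E \<longleftrightarrow> finite V \<and> (\<forall>e\<in>E. e \<subseteq> V \<and> card e = r)"

definition Kedges :: "nat \<Rightarrow> 'a set \<Rightarrow> 'a set set" where
  "Kedges r Q = {e. e \<subseteq> Q \<and> card e = r}"

definition has_Kqr_decomposition :: "nat \<Rightarrow> nat \<Rightarrow> 'a set \<Rightarrow> 'a set set \<Rightarrow> bool" where
  "has_Kqr_decomposition q r V E \<longleftrightarrow>
     (\<exists>\<Q>. (\<forall>Q\<in>\<Q>. Q \<subseteq> V \<and> finite Q \<and> card Q = q)
         \<and> (\<forall>Q1\<in>\<Q>. \<forall>Q2\<in>\<Q>. Q1 \<noteq> Q2 \<longrightarrow> Kedges r Q1 \<inter> Kedges r Q2 = {})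
         \<and> (\<Union>Q\<in>\<Q>. Kedges r Q) = E)"

definition Kqr_divisible :: "nat \<Rightarrow> nat \<Rightarrow> 'a set \<Rightarrow> 'a set set \<Rightarrow> bool" where
  "Kqr_divisible q r V E \<longleftrightarrow>
     (\<forall>i<r. \<forall>S. S \<subseteq> V \<and> card S = i \<longrightarrow>
        ((q - i) choose (r - i)) dvd card {e\<in>E. S \<subseteq> e})"

definition independent_in :: "'a set \<Rightarrow> 'a set set \<Rightarrow> bool" where
  "independent_in X E \<longleftrightarrow> (\<forall>e\<in>E. \<not> e \<subseteq> X)"

definition Kqr_absorber :: "nat \<Rightarrow> nat \<Rightarrow> 'a set \<Rightarrow> 'a set set \<Rightarrow> 'a set \<Rightarrow> 'a set set \<Rightarrow> bool" where
  "Kqr_absorber q r VL EL VA EA \<longleftrightarrow>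
     VL \<subseteq> VA \<and> independent_in VL EA
     \<and> has_Kqr_decomposition q r VA EA
     \<and> has_Kqr_decomposition q r (VL \<union> VA) (EL \<union> EA)"

end

theory Submission
  imports Defs "HOL-Library.Multiset" "HOL-Computational_Algebra.Polynomial"
    "HOL-Computational_Algebra.Primes"
begin

text \<open>
  Divisibility makes the indicator of the edge set of \<open>L\<close> an integer combination of cliques: once all
  degrees of sets of fewer than \<open>i\<close> vertices vanish, the function \<open>d\<close> on \<open>i\<close>-sets given by the
  \<open>i\<close>-degrees over \<open>q - i choose r - i\<close> has vanishing lower degrees, and subtracting \<open>d e\<close> times the
  clique on \<open>e \<union> W\<close> for every \<open>i\<close>-set \<open>e\<close>, with one fixed fresh \<open>W\<close> of size \<open>q - i\<close>, kills the
  \<open>i\<close>-degrees as well.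

  To turn the signed sum into disjoint decompositions, take a prime \<open>p > q\<close> and the \<open>q\<close>-partite
  \<open>r\<close>-graph of all partial transversals of \<open>q\<close> copies of the integers mod \<open>p\<close>. By interpolation the
  graphs of the polynomials of degree less than \<open>r\<close> decompose it, and so do the graphs of these
  polynomials shifted by one monic polynomial of degree \<open>r\<close>; cliques of different decompositions
  share at most \<open>r\<close> vertices. Swapping the two decompositions replaces a signed clique by signed
  cliques with at most one edge among the old vertices. Chaining three swaps cancels a positive against a
  negative clique through a common old edge; when no negative clique has an old edge left, the
  negative cliques form a decomposition of the absorber.
\<close>

section \<open>Two transversal decompositions from polynomials modulo a prime\<close>

lemma int_eq_if_dvd_diff:
  fixes i j p :: int
  assumes "i \<in> {0..<p}" "j \<in> {0..<p}" "p dvd i - j"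
  shows "i = j"
proof -
  have "i mod p = j mod p" using assms(3) by (simp add: mod_eq_dvd_iff)
  then show ?thesis using assms by simp
qed

text \<open>Synthetic division at one root \<open>a\<close> leaves a quotient of smaller degree, and
  primality passes the other roots to it because \<open>p\<close> does not divide
  \<open>j - a\<close> for distinct residues. The degree is the one over the integers and the
  conclusion concerns values only, so the argument stays with integer polynomials.\<close>

lemma dvd_poly_if_many_roots:
  fixes h :: "int poly" and p :: int
  assumes "prime p" "degree h \<le> n" "card I = Suc n" "I \<subseteq> {0..<p}"
    and "\<And>i. i \<in> I \<Longrightarrow> p dvd poly h i"
  shows "p dvd poly h x"
  using assms(2-)
proof (induction n arbitrary: h I)
  case 0
  then obtain a c where "I = {a}" "h = [:c:]"
    by (metis One_nat_def card_1_singletonE degree_eq_zeroE le_zero_eq)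
  with 0 show ?case by auto
next
  case (Suc n)
  then obtain a J where IJ: "I = insert a J" "a \<notin> J" "card J = Suc n"
    by (metis card_Suc_eq)
  define k where "k = synthetic_div h a"
  have h: "poly h y = (y - a) * poly k y + poly h a" for y
    using arg_cong[OF synthetic_div_correct'[of a h], of "\<lambda>u. poly u y"]
    by (simp add: k_def algebra_simps)
  have pa: "p dvd poly h a" using Suc.prems IJ by auto
  have "p dvd poly k x"
  proof (rule Suc.IH)
    show "degree k \<le> n" using Suc.prems by (simp add: k_def degree_synthetic_div)
    show "card J = Suc n" "J \<subseteq> {0..<p}" using IJ Suc.prems by auto
    fix j assume j: "j \<in> J"
    have "p dvd (j - a) * poly k j"
      using h[of j] pa Suc.prems(4)[of j] IJ j by (metis dvd_add_left_iff insertCI)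
    moreover have "\<not> p dvd j - a"
      using int_eq_if_dvd_diff[of j p a] IJ Suc.prems j by auto
    ultimately show "p dvd poly k j"
      using \<open>prime p\<close> by (simp add: prime_dvd_mult_iff)
  qed
  then show ?case using h[of x] pa by simp
qed

text \<open>Newton interpolation: a multiple of the product \<open>w\<close> over the old nodes
  corrects the value at the new node \<open>a\<close> without disturbing the old ones. The degree
  bound is phrased through coefficients to cover the empty node set, where \<open>h\<close> is 0 and
  \<open>degree h < 0\<close> would fail.\<close>

lemma interpolation_mod_prime:
  fixes p :: int and v :: "int \<Rightarrow> int"
  assumes "prime p" "finite I" "I \<subseteq> {0..<p}"
  shows "\<exists>h. (\<forall>k\<ge>card I. coeff h k = 0) \<and> (\<forall>i\<in>I. p dvd poly h i - v i)"
  using assms(2,3)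
proof (induction I rule: finite_induct)
  case empty
  show ?case by (auto intro: exI[of _ 0])
next
  case (insert a J)
  then obtain h where h: "\<forall>k\<ge>card J. coeff h k = 0" "\<forall>i\<in>J. p dvd poly h i - v i"
    by auto
  define w where "w = (\<Prod>j\<in>J. [:-j, 1:])"
  have w: "poly w y = (\<Prod>j\<in>J. y - j)" for y
    by (simp add: w_def poly_prod)
  have dw: "degree w = card J"
    by (simp add: w_def degree_prod_eq_sum_degree)
  have "\<not> p dvd poly w a"
  proof
    assume "p dvd poly w a"
    then obtain j where "j \<in> J" "p dvd a - j"
      unfolding w using \<open>prime p\<close> insert.hyps by (auto simp: prime_dvd_prod_iff)
    then show False using int_eq_if_dvd_diff[of a p j] insert by auto
  qed
  then have "coprime p (poly w a)" using \<open>prime p\<close> by (simp add: prime_imp_coprime)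
  then obtain s t where st: "s * p + t * poly w a = 1"
    using bezout_int[of p "poly w a"] by (metis coprime_imp_gcd_eq_1)
  \<comment> \<open>\<open>t\<close> inverts \<open>poly w a\<close> modulo \<open>p\<close>, so
    \<open>c\<close> is the coefficient that moves the value at \<open>a\<close> to
    \<open>v a\<close>.\<close>
  define c where "c = t * (v a - poly h a)"
  have "poly h a + c * poly w a - v a = (v a - poly h a) * (t * poly w a - 1)"
    by (simp add: c_def algebra_simps)
  also have "\<dots> = p * (- s * (v a - poly h a))"
  proof -
    have "t * poly w a - 1 = - s * p" using st by linarith
    then show ?thesis by simp
  qed
  finally have a: "p dvd poly (h + smult c w) a - v a" by simp
  have "p dvd poly (h + smult c w) i - v i" if "i \<in> J" for i
  proof -
    have "poly w i = 0" unfolding w using that insert.hyps by auto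
    then show ?thesis using h that by simp
  qed
  moreover have "coeff (h + smult c w) k = 0" if "k \<ge> card (insert a J)" for k
    using that h dw insert.hyps by (simp add: coeff_eq_0)
  ultimately show ?case using a by (intro exI[of _ "h + smult c w"]) auto
qed

section \<open>Edge multiplicities in multisets of cliques\<close>

definition cov :: "nat \<Rightarrow> 'a set multiset \<Rightarrow> 'a set \<Rightarrow> nat" where
  "cov r M f = size {#Q \<in># M. f \<in> Kedges r Q#}"

lemma cov_simps [simp]:
  "cov r {#} f = 0"
  "cov r (add_mset Q M) f = (if f \<in> Kedges r Q then Suc (cov r M f) else cov r M f)"
  "cov r (M + N) f = cov r M f + cov r N f"
  by (simp_all add: cov_def)

lemma cov_eq_0_iff: "cov r M f = 0 \<longleftrightarrow> (\<forall>Q\<in>#M. f \<notin> Kedges r Q)"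
  by (auto simp: cov_def filter_mset_eq_conv)

lemma cov_pos_iff: "0 < cov r M f \<longleftrightarrow> (\<exists>Q\<in>#M. f \<in> Kedges r Q)"
  using cov_eq_0_iff[of r M f] by auto

lemma cov_mset_set:
  "finite D \<Longrightarrow> cov r (mset_set D) f = card {Q \<in> D. f \<in> Kedges r Q}"
  by (simp add: cov_def filter_mset_mset_set)

text \<open>A Reed-Solomon code word, written as the graph of a function: it has one vertex in each
  of \<open>q\<close> parts and so spans a clique of the transversal \<open>r\<close>-graph.\<close>

definition code_word :: "nat \<Rightarrow> nat \<Rightarrow> int poly \<Rightarrow> (nat \<times> int) set" where
  "code_word q p h = (\<lambda>i. (i, poly h (int i) mod int p)) ` {..<q}"

lemma card_code_word: "card (code_word q p h) = q"
  by (simp add: code_word_def card_image inj_on_def)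

lemma mem_code_word_iff:
  "(i, y) \<in> code_word q p h \<longleftrightarrow> i < q \<and> y = poly h (int i) mod int p"
  by (auto simp: code_word_def)

lemma code_word_eqI:
  "(\<And>i. i < q \<Longrightarrow> int p dvd poly h (int i) - poly k (int i)) \<Longrightarrow> code_word q p h = code_word q p k"
  by (auto simp: code_word_def mod_eq_dvd_iff intro!: image_cong)

text \<open>Turns incidence with code words into congruences at the first coordinates, where root
  counting and interpolation apply. The bound \<open>q \<le> p\<close> keeps distinct coordinates
  distinct modulo \<open>p\<close>.\<close>

lemma subset_code_word:
  assumes "f \<subseteq> code_word q p h" "card f = r" "q \<le> p"
  shows "card (int ` fst ` f) = r" "int ` fst ` f \<subseteq> {0..<int p}" "finite (int ` fst ` f)"
    "\<And>k. f \<subseteq> code_word q p k \<longleftrightarrow> (\<forall>i\<in>int ` fst ` f. int p dvd poly k i - poly h i)"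
proof -
  have fin: "finite f" using assms(1) by (rule finite_subset) (simp add: code_word_def)
  have "inj_on fst f"
    by (rule inj_on_subset[OF _ assms(1)]) (auto simp: inj_on_def code_word_def)
  then show "card (int ` fst ` f) = r"
    using assms(2) by (simp add: card_image)
  show "int ` fst ` f \<subseteq> {0..<int p}" using assms(1,3) by (auto simp: code_word_def)
  show "finite (int ` fst ` f)" using fin by simp
  have *: "i < q \<and> y = poly h (int i) mod int p" if "(i, y) \<in> f" for i y
    using that assms(1) mem_code_word_iff[of i y q p h] by auto
  show "f \<subseteq> code_word q p k \<longleftrightarrow> (\<forall>i\<in>int ` fst ` f. int p dvd poly k i - poly h i)" for k
  proof -
    have "f \<subseteq> code_word q p k \<longleftrightarrow> (\<forall>(i, y)\<in>f. (i, y) \<in> code_word q p k)" by auto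
    also have "\<dots> \<longleftrightarrow> (\<forall>(i, y)\<in>f. int p dvd poly k (int i) - poly h (int i))"
    proof (intro ball_cong refl, clarify)
      fix i y assume "(i, y) \<in> f"
      from *[OF this] show "(i, y) \<in> code_word q p k \<longleftrightarrow> int p dvd poly k (int i) - poly h (int i)"
        unfolding mem_code_word_iff mod_eq_dvd_iff[symmetric] by auto
    qed
    also have "\<dots> \<longleftrightarrow> (\<forall>i\<in>int ` fst ` f. int p dvd poly k i - poly h i)"
      by (simp add: case_prod_beta)
    finally show ?thesis .
  qed
qed

text \<open>\<open>D1\<close> comes from the polynomials of degree below \<open>r\<close>,
  \<open>D2\<close> from their shifts by a monic \<open>g\<close> of degree \<open>r\<close>. Values
  modulo \<open>p\<close> at \<open>r\<close> positions can be prescribed and determine all others,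
  so either family covers each partial transversal of size \<open>r\<close> exactly once. Each
  member of \<open>D2\<close> differs from the zero word by a monic polynomial of degree
  \<open>r\<close>, which has at most \<open>r\<close> roots modulo \<open>p\<close>.\<close>

lemma code_families:
  fixes q r :: nat
  assumes "1 \<le> r" "r < q"
  obtains X :: "(nat \<times> int) set" and D1 D2 Q0 R0 where
    "finite X" "finite D1" "finite D2"
    "\<And>S. S \<in> D1 \<union> D2 \<Longrightarrow> S \<subseteq> X \<and> card S = q"
    "Q0 \<in> D1" "R0 \<in> D2" "card (Q0 \<inter> R0) = r"
    "\<And>T. T \<in> D2 \<Longrightarrow> card (T \<inter> Q0) \<le> r"
    "\<And>f. cov r (mset_set D1) f = cov r (mset_set D2) f"
    "\<And>f. cov r (mset_set D1) f \<le> 1"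
proof -
  obtain p where p: "prime p" "q < p" using bigger_prime by blast
  have ip: "prime (int p)" using p by simp
  \<comment> \<open>Among the positions below \<open>q\<close> the roots of \<open>g\<close> modulo
    \<open>p\<close> are exactly the first \<open>r\<close>, so the words of 0 and \<open>g\<close>
    share exactly \<open>r\<close> vertices.\<close>
  define g where "g = (\<Prod>j<r. [:- int j, 1:])"
  have g: "poly g y = (\<Prod>j<r. y - int j)" for y by (simp add: g_def poly_prod)
  define X where "X = {..<q} \<times> {0..<int p}"
  define D where "D k = (\<lambda>h. code_word q p (k + h)) ` {h. degree h < r}" for k
  have inX: "code_word q p h \<subseteq> X" for h
    using p prime_gt_0_int[OF ip] by (auto simp: code_word_def X_def)
  have finX: "finite X" by (simp add: X_def)
  \<comment> \<open>Infinitely many integer polynomials yield finitely many words, since all words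
    lie in the finite set \<open>X\<close>.\<close>
  have finD: "finite (D k)" for k
    by (rule finite_subset[of _ "Pow X"]) (use inX finX in \<open>auto simp: D_def\<close>)
  have eq_if_agree: "code_word q p h = code_word q p k"
    if "degree (h - k) < r" "f \<subseteq> code_word q p h" "f \<subseteq> code_word q p k" "card f = r" for h k f
  proof (rule code_word_eqI)
    note sc = subset_code_word[OF that(3) that(4)]
    have "q \<le> p" using p by simp
    note sc = sc[OF this]
    show "int p dvd poly h (int i) - poly k (int i)" for i
      unfolding poly_diff[symmetric]
    proof (rule dvd_poly_if_many_roots[OF ip])
      show "degree (h - k) \<le> r - 1" using that(1) by linarith
      show "card (int ` fst ` f) = Suc (r - 1)" using sc(1) assms by linarith
      show "int ` fst ` f \<subseteq> {0..<int p}" by (fact sc(2))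
      show "int p dvd poly (h - k) i" if "i \<in> int ` fst ` f" for i
        using sc(4)[THEN iffD1, OF \<open>f \<subseteq> code_word q p h\<close>] that unfolding poly_diff by blast
    qed
  qed
  have le1: "cov r (mset_set (D k)) f \<le> 1" for k f
  proof -
    have "S = T" if ST: "S \<in> D k" "T \<in> D k" "f \<in> Kedges r S" "f \<in> Kedges r T" for S T
    proof -
      obtain h h' where "S = code_word q p (k + h)" "T = code_word q p (k + h')"
        "degree h < r" "degree h' < r"
        using ST by (auto simp: D_def)
      then show ?thesis using ST eq_if_agree[of "k + h" "k + h'" f]
        by (simp add: Kedges_def degree_diff_less)
    qed
    then show ?thesis
      by (auto simp: cov_mset_set finD card_le_Suc0_iff_eq)
  qed
  have cov_D: "0 < cov r (mset_set (D k)) f \<longleftrightarrow>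
      card f = r \<and> (\<exists>h. degree h < r \<and> f \<subseteq> code_word q p (k + h))" for k f
    unfolding cov_pos_iff finite_set_mset_mset_set[OF finD] by (fastforce simp: D_def Kedges_def)
  have covered: "0 < cov r (mset_set (D l)) f" if pos: "0 < cov r (mset_set (D k)) f" for k l f
  proof -
    obtain h where h: "f \<subseteq> code_word q p (k + h)" "card f = r"
      using pos unfolding cov_D by blast
    have "q \<le> p" using p by simp
    note sc = subset_code_word[OF h this]
    obtain m where m: "\<forall>n\<ge>r. coeff m n = 0"
      "\<forall>i\<in>int ` fst ` f. int p dvd poly m i - (poly (k + h) i - poly l i)"
      using interpolation_mod_prime[OF ip sc(3) sc(2), of "\<lambda>i. poly (k + h) i - poly l i"]
      unfolding sc(1) by blast
    have "degree m < r" using m(1) assms(1) by (intro degree_lessI) auto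
    moreover have "f \<subseteq> code_word q p (l + m)"
    proof (subst sc(4))
      show "\<forall>i\<in>int ` fst ` f. int p dvd poly (l + m) i - poly (k + h) i"
        using m(2) by (simp add: algebra_simps)
    qed
    ultimately show ?thesis using h(2) unfolding cov_D by blast
  qed
  have eq: "cov r (mset_set (D k)) f = cov r (mset_set (D l)) f" for k l f
    using le1[of k f] le1[of l f] covered[of k f l] covered[of l f k] by linarith
  have gi: "int p dvd poly g (int i) \<longleftrightarrow> i < r" if "i < q" for i
  proof -
    have "int p dvd poly g (int i) \<longleftrightarrow> (\<exists>j<r. int p dvd int i - int j)"
      using ip by (auto simp: g prime_dvd_prod_iff)
    also have "\<dots> \<longleftrightarrow> i < r"
    proof
      assume "\<exists>j<r. int p dvd int i - int j"
      then obtain j where "j < r" "int p dvd int i - int j" by blast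
      then show "i < r"
        using int_eq_if_dvd_diff[of "int i" "int p" "int j"] that p assms by simp
    next
      assume "i < r" then show "\<exists>j<r. int p dvd int i - int j" by (intro exI[of _ i]) auto
    qed
    finally show ?thesis .
  qed
  have degg: "degree g = r" "lead_coeff g = 1"
    unfolding g_def lead_coeff_prod by (simp_all add: degree_prod_eq_sum_degree)
  show thesis
  proof (rule that[of X "D 0" "D g" "code_word q p 0" "code_word q p g"])
    show "finite X" "finite (D 0)" "finite (D g)" using finX finD by auto
    show "code_word q p 0 \<in> D 0" "code_word q p g \<in> D g"
      unfolding D_def by (rule image_eqI[of _ _ 0]; use assms in simp)+
    show "S \<subseteq> X \<and> card S = q" if "S \<in> D 0 \<union> D g" for S
      using that inX card_code_word by (auto simp: D_def)
    have "code_word q p 0 \<inter> code_word q p g = (\<lambda>i. (i, 0)) ` {..<r}"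
    proof (intro set_eqI iffI)
      fix x assume x: "x \<in> code_word q p 0 \<inter> code_word q p g"
      obtain i y where iy: "x = (i, y)" by fastforce
      with x have "i < q" "y = 0" "int p dvd poly g (int i)"
        by (auto simp: mem_code_word_iff)
      then show "x \<in> (\<lambda>i. (i, 0)) ` {..<r}" using gi iy by auto
    next
      fix x :: "nat \<times> int" assume "x \<in> (\<lambda>i. (i, 0)) ` {..<r}"
      then show "x \<in> code_word q p 0 \<inter> code_word q p g"
        using gi assms by (auto simp: mem_code_word_iff)
    qed
    then show "card (code_word q p 0 \<inter> code_word q p g) = r"
      by (simp add: card_image inj_on_def)
    show "cov r (mset_set (D 0)) f = cov r (mset_set (D g)) f"
      "cov r (mset_set (D 0)) f \<le> 1" for f using eq le1 by auto
    fix T assume "T \<in> D g"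
    then obtain h where h: "T = code_word q p (g + h)" "degree h < r" by (auto simp: D_def)
    define m where "m = g + h"
    have m: "degree m = r" "lead_coeff m = 1"
      unfolding m_def using h degg by (auto simp: degree_add_eq_left coeff_eq_0)
    show "card (T \<inter> code_word q p 0) \<le> r"
    proof (rule ccontr)
      assume "\<not> ?thesis"
      then obtain f where f: "f \<subseteq> T \<inter> code_word q p 0" "card f = Suc r"
        by (meson not_less_eq_eq obtain_subset_with_card_n)
      then have fm: "f \<subseteq> code_word q p m" "f \<subseteq> code_word q p 0" by (auto simp: h m_def)
      have "q \<le> p" using p by simp
      note sc = subset_code_word[OF fm(2) f(2) this]
      have roots: "\<forall>i\<in>int ` fst ` f. int p dvd poly m i"
        using sc(4)[THEN iffD1, OF fm(1)] by simp
      obtain a J where aJ: "int ` fst ` f = insert a J" "a \<notin> J" "card J = r"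
        using sc(1) card_Suc_eq by metis
      then have finJ: "finite J" using sc(3) by simp
      \<comment> \<open>\<open>m\<close> and \<open>w\<close> are both monic of degree
        \<open>r\<close>, so \<open>m - w\<close> has degree below \<open>r\<close>. It vanishes
        modulo \<open>p\<close> on \<open>J\<close>, hence also at \<open>a\<close>; then
        \<open>w\<close> vanishes at \<open>a\<close> as well, although \<open>a\<close> is not in
        \<open>J\<close>.\<close>
      define w where "w = (\<Prod>j\<in>J. [:- j, 1:])"
      have w: "poly w y = (\<Prod>j\<in>J. y - j)" for y by (simp add: w_def poly_prod)
      have dw: "degree w = r" "lead_coeff w = 1"
        unfolding w_def lead_coeff_prod by (simp_all add: degree_prod_eq_sum_degree aJ)
      have "degree (m - w) < r"
      proof (rule degree_lessI)
        show "\<forall>k\<ge>r. coeff (m - w) k = 0"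
          using m dw by (metis cancel_comm_monoid_add_class.diff_cancel coeff_diff coeff_eq_0 le_neq_implies_less)
      qed (use assms in simp)
      moreover have "int p dvd poly (m - w) i" if "i \<in> J" for i
        using that roots aJ finJ by (simp add: w prod_zero)
      ultimately have "int p dvd poly (m - w) a"
        using aJ sc(2) assms by (intro dvd_poly_if_many_roots[OF ip, of "m - w" "r - 1" J a]) auto
      moreover have "int p dvd poly m a" using roots aJ by simp
      ultimately have "int p dvd poly w a" by (simp add: dvd_diff_right_iff)
      then obtain j where "j \<in> J" "int p dvd a - j"
        using ip finJ by (auto simp: w prime_dvd_prod_iff)
      then show False using int_eq_if_dvd_diff[of a "int p" j] aJ sc(2) p by auto
    qed
  qed
qed

section \<open>Replacing and cancelling signed cliques\<close>

lemma obtain_fresh: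
  assumes "infinite (UNIV :: 'a set)" "finite (U :: 'a set)"
  obtains W where "finite W" "card W = n" "W \<inter> U = {}"
proof -
  have "infinite (- U)" using assms by (simp add: Compl_eq_Diff_UNIV)
  then obtain W where "finite W" "card W = n" "W \<subseteq> - U"
    using infinite_arbitrarily_large by blast
  then show thesis using that[of W] by auto
qed

text \<open>The three Venn regions of \<open>Q0\<close> and \<open>R0\<close> have the sizes of
  those of \<open>Q\<close> and \<open>R\<close>, which allows separate bijections; the rest of
  \<open>X\<close> goes to fresh vertices, so the copy meets \<open>U\<close> only inside
  \<open>Q \<union> R\<close>.\<close>

lemma obtain_embedding:
  fixes Q R U :: "'a set" and X Q0 R0 :: "'b set"
  assumes inf: "infinite (UNIV :: 'a set)" and fin: "finite X" "finite Q" "finite R" "finite U"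
    and sub: "Q0 \<subseteq> X" "R0 \<subseteq> X"
    and card: "card Q0 = card Q" "card R0 = card R" "card (Q0 \<inter> R0) = card (Q \<inter> R)"
  obtains \<iota> where "inj_on \<iota> X" "\<iota> ` Q0 = Q" "\<iota> ` R0 = R" "\<iota> ` X \<inter> U \<subseteq> Q \<union> R"
proof -
  have fin0: "finite Q0" "finite R0" using sub fin finite_subset by auto
  obtain W where W: "finite W" "card W = card (X - (Q0 \<union> R0))" "W \<inter> (U \<union> Q \<union> R) = {}"
    using obtain_fresh[OF inf] fin by (metis finite_UnI)
  have "card (Q0 - R0) = card (Q - R)" "card (R0 - Q0) = card (R - Q)"
    using card fin fin0 by (simp_all add: card_Diff_subset_Int Int_commute)
  then obtain a b c d where bij:
    "bij_betw a (Q0 \<inter> R0) (Q \<inter> R)" "bij_betw b (Q0 - R0) (Q - R)"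
    "bij_betw c (R0 - Q0) (R - Q)" "bij_betw d (X - (Q0 \<union> R0)) W"
    using card fin fin0 W
    by (metis finite_same_card_bij finite_Int finite_Diff)
  define \<iota> where "\<iota> x = (if x \<in> Q0 then if x \<in> R0 then a x else b x
      else if x \<in> R0 then c x else d x)" for x
  have *: "bij_betw \<iota> (Q0 \<inter> R0) (Q \<inter> R)" "bij_betw \<iota> (Q0 - R0) (Q - R)"
    "bij_betw \<iota> (R0 - Q0) (R - Q)" "bij_betw \<iota> (X - (Q0 \<union> R0)) W"
    by (rule bij_betw_cong[THEN iffD1, OF _ bij(1)], simp add: \<iota>_def)
      (rule bij_betw_cong[THEN iffD1, OF _ bij(2)], simp add: \<iota>_def,
       rule bij_betw_cong[THEN iffD1, OF _ bij(3)], simp add: \<iota>_def,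
       rule bij_betw_cong[THEN iffD1, OF _ bij(4)], simp add: \<iota>_def)
  have Q: "bij_betw \<iota> Q0 Q"
    using bij_betw_combine[OF *(1,2)] by (auto simp: Int_Diff_Un)
  have R: "bij_betw \<iota> R0 R"
    using bij_betw_combine[OF *(1,3)] by (auto simp: Int_Diff_Un Int_commute[of Q0] Int_commute[of Q])
  have QR: "bij_betw \<iota> (Q0 \<union> R0) (Q \<union> R)"
    using bij_betw_combine[OF Q *(3)] by auto
  have X: "bij_betw \<iota> X (Q \<union> R \<union> W)"
    using bij_betw_combine[OF QR *(4)] W(3) sub
    by (metis Int_commute Un_Diff_cancel Un_absorb1 Un_assoc Un_least inf_sup_distrib1 sup_bot.neutr_eq_iff)
  show thesis
    using that[of \<iota>] X Q R W(3) by (auto simp: bij_betw_def)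
qed

text \<open>Adding \<open>R\<close> to \<open>A\<close> and \<open>Q\<close> to \<open>B\<close> gives two clique decompositions of one graph, so
  \<open>A\<close> minus \<open>B\<close> equals \<open>Q\<close> minus \<open>R\<close> as signed sums of edges.\<close>

definition switching ::
    "nat \<Rightarrow> nat \<Rightarrow> 'a set \<Rightarrow> 'a set \<Rightarrow> 'a set \<Rightarrow> 'a set multiset \<Rightarrow> 'a set multiset \<Rightarrow> bool" where
  "switching q r U Q R A B \<longleftrightarrow>
     (\<forall>S\<in>#add_mset R A + add_mset Q B. card S = q \<and> S \<inter> U \<subseteq> Q \<union> R) \<and>
     (\<forall>S\<in>#add_mset R A. card (S \<inter> Q) \<le> r) \<and>
     (\<forall>f. cov r (add_mset R A) f = cov r (add_mset Q B) f) \<and>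
     (\<forall>f. cov r (add_mset R A) f \<le> 1)"

lemma switchingD:
  assumes "switching q r U Q R A B"
  shows "S \<in># add_mset R A + add_mset Q B \<Longrightarrow> card S = q \<and> S \<inter> U \<subseteq> Q \<union> R"
    and "S \<in># add_mset R A \<Longrightarrow> card (S \<inter> Q) \<le> r"
    and "cov r (add_mset R A) f = cov r (add_mset Q B) f"
    and "cov r (add_mset R A) f \<le> 1"
  using assms unfolding switching_def by blast+

lemma finite_Union_switching:
  assumes "switching q r U Q R A B" "0 < q"
  shows "finite (\<Union>(set_mset (add_mset R A + add_mset Q B)))"
proof (rule finite_Union)
  show "finite S" if "S \<in> set_mset (add_mset R A + add_mset Q B)" for S
    using switchingD(1)[OF assms(1) that] assms(2) card_ge_0_finite[of S] by linarith
qed simp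

lemma switching_cov_posD:
  assumes "switching q r U Q R A B" "0 < cov r (add_mset R A) f"
  shows "card f = r" "f \<inter> U \<subseteq> Q \<union> R" "f \<subseteq> \<Union>(set_mset (add_mset R A + add_mset Q B))"
proof -
  obtain S where S: "S \<in># add_mset R A" "f \<in> Kedges r S"
    using assms(2) unfolding cov_pos_iff by blast
  have "S \<in># add_mset R A + add_mset Q B" using S(1) by auto
  with S(2) switchingD(1)[OF assms(1) this] show "card f = r" "f \<inter> U \<subseteq> Q \<union> R"
    "f \<subseteq> \<Union>(set_mset (add_mset R A + add_mset Q B))"
    unfolding Kedges_def by blast+
qed

text \<open>The two code families are copied along an embedding that sends \<open>Q0\<close> to
  \<open>Q\<close> and \<open>R0\<close> to \<open>R\<close>; removing these two cliques leaves
  \<open>B\<close> and \<open>A\<close>.\<close>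

lemma ex_switching:
  fixes Q R U :: "'a set"
  assumes inf: "infinite (UNIV :: 'a set)" and r: "1 \<le> r" "r < q"
    and QR: "card Q = q" "card R = q" "card (Q \<inter> R) = r" and U: "finite U"
  shows "\<exists>A B. switching q r U Q R A B"
proof -
  from r obtain X :: "(nat \<times> int) set" and D1 D2 Q0 R0 where D:
    "finite X" "finite D1" "finite D2"
    "\<And>S. S \<in> D1 \<union> D2 \<Longrightarrow> S \<subseteq> X \<and> card S = q"
    "Q0 \<in> D1" "R0 \<in> D2" "card (Q0 \<inter> R0) = r"
    "\<And>T. T \<in> D2 \<Longrightarrow> card (T \<inter> Q0) \<le> r"
    "\<And>f. cov r (mset_set D1) f = cov r (mset_set D2) f"
    "\<And>f. cov r (mset_set D1) f \<le> 1"
    by (rule code_families) blast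
  have finQR: "finite Q" "finite R" using QR r by (auto intro: card_ge_0_finite)
  have sub: "Q0 \<subseteq> X" "R0 \<subseteq> X" "card Q0 = card Q" "card R0 = card R"
    "card (Q0 \<inter> R0) = card (Q \<inter> R)"
    using D(4)[of Q0] D(4)[of R0] D(5-7) QR by auto
  obtain \<iota> where \<iota>: "inj_on \<iota> X" "\<iota> ` Q0 = Q" "\<iota> ` R0 = R" "\<iota> ` X \<inter> U \<subseteq> Q \<union> R"
    using obtain_embedding[OF inf D(1) finQR U sub(1-5)] by blast
  define M where "M D = image_mset ((`) \<iota>) (mset_set D)" for D
  \<comment> \<open>Multiplicities are transported back along the injection: an edge of the copy is
    covered as often as its preimage in \<open>X\<close>.\<close>
  have cov_M: "cov r (M D) f = (if f \<subseteq> \<iota> ` X then cov r (mset_set D) (X \<inter> \<iota> -` f) else 0)"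
    if "D \<subseteq> D1 \<union> D2" for D f
  proof -
    have fin: "finite D" using that D(2,3) by (meson finite_UnI finite_subset)
    have *: "f \<in> Kedges r (\<iota> ` S) \<longleftrightarrow> f \<subseteq> \<iota> ` X \<and> X \<inter> \<iota> -` f \<in> Kedges r S" if "S \<in> D" for S
    proof -
      have S: "S \<subseteq> X" using D(4)[of S] \<open>D \<subseteq> D1 \<union> D2\<close> that by auto
      have "f \<subseteq> \<iota> ` S \<longleftrightarrow> X \<inter> \<iota> -` f \<subseteq> S" if "f \<subseteq> \<iota> ` X"
        using that S \<iota>(1) by (auto simp: inj_on_def) blast+
      moreover have "card f = card (X \<inter> \<iota> -` f)" if "f \<subseteq> \<iota> ` X"
      proof -
        have "f = \<iota> ` (X \<inter> \<iota> -` f)" using that by auto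
        then show ?thesis using card_image[OF inj_on_subset[OF \<iota>(1)], of "X \<inter> \<iota> -` f"] by simp
      qed
      moreover have "f \<subseteq> \<iota> ` S \<Longrightarrow> f \<subseteq> \<iota> ` X" using S by blast
      ultimately show ?thesis unfolding Kedges_def mem_Collect_eq by metis
    qed
    have "cov r (M D) f = size {#S \<in># mset_set D. f \<in> Kedges r (\<iota> ` S)#}"
      by (simp add: cov_def M_def filter_mset_image_mset)
    also have "\<dots> = size {#S \<in># mset_set D. f \<subseteq> \<iota> ` X \<and> X \<inter> \<iota> -` f \<in> Kedges r S#}"
      using * fin by (intro arg_cong[where f = size] filter_mset_cong) auto
    also have "\<dots> = (if f \<subseteq> \<iota> ` X then cov r (mset_set D) (X \<inter> \<iota> -` f) else 0)"
      by (simp add: cov_def)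
    finally show ?thesis .
  qed
  have M1: "add_mset Q (M (D1 - {Q0})) = M D1"
    using D(2,5) \<iota>(2) by (metis M_def image_mset_add_mset mset_set.remove)
  have M2: "add_mset R (M (D2 - {R0})) = M D2"
    using D(3,6) \<iota>(3) by (metis M_def image_mset_add_mset mset_set.remove)
  show ?thesis
  proof (rule exI[of _ "M (D2 - {R0})"], rule exI[of _ "M (D1 - {Q0})"],
      unfold switching_def M1 M2, intro conjI ballI allI)
    fix S assume S: "S \<in># M D2 + M D1"
    then obtain S0 where S0: "S0 \<in> D1 \<union> D2" "S = \<iota> ` S0" using D(2,3) by (auto simp: M_def)
    then show "card S = q" using D(4) \<iota>(1) by (metis card_image inj_on_subset)
    show "S \<inter> U \<subseteq> Q \<union> R" using D(4)[OF S0(1)] S0(2) \<iota>(4) by blast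
  next
    show "card (S \<inter> Q) \<le> r" if S: "S \<in># M D2" for S
    proof -
      obtain T where T: "T \<in> D2" "S = \<iota> ` T" using S D(3) by (auto simp: M_def)
      then have "S \<inter> Q = \<iota> ` (T \<inter> Q0)"
        using inj_on_image_Int[OF \<iota>(1), of T Q0] D(4)[of T] sub(1) \<iota>(2) by auto
      then show ?thesis using D(8)[OF T(1)] card_image_le[of "T \<inter> Q0" \<iota>] D(1) sub(1)
        by (metis finite_Int finite_subset le_trans)
    qed
    show "cov r (M D2) f = cov r (M D1) f" for f
      unfolding cov_M[OF Un_upper1] cov_M[OF Un_upper2] D(9) by simp
    show "cov r (M D2) f \<le> 1" for f
      unfolding cov_M[OF Un_upper2] D(9)[symmetric] using D(10) by simp
  qed
qed

text \<open>Rewrites one clique inside \<open>U\<close> as a signed sum of cliques that each have at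
  most one edge in \<open>U\<close>. The switching partner \<open>R\<close> meets \<open>U\<close>
  only in an \<open>r\<close>-subset \<open>e\<close> of \<open>Q\<close>, so every clique involved
  meets \<open>U\<close> inside \<open>Q\<close>.\<close>

lemma boost:
  fixes Q U :: "'a set"
  assumes inf: "infinite (UNIV :: 'a set)" and r: "1 \<le> r" "r < q"
    and Q: "card Q = q" "Q \<subseteq> U" and U: "finite U"
  obtains A B where
    "\<And>S. S \<in># A + B \<Longrightarrow> card S = q \<and> card (S \<inter> U) \<le> r"
    "\<And>f. f \<subseteq> U \<Longrightarrow> cov r A f = of_bool (f \<in> Kedges r Q) \<and> cov r B f = 0"
    "\<And>f. \<not> f \<subseteq> U \<Longrightarrow> cov r A f = cov r B f \<and> cov r A f \<le> 1"
proof -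
  have finQ: "finite Q" using Q(2) U by (rule finite_subset)
  obtain e where e: "e \<subseteq> Q" "card e = r" "finite e"
    using obtain_subset_with_card_n[of r Q] Q r by auto
  obtain W where W: "finite W" "card W = q - r" "W \<inter> U = {}"
    using obtain_fresh[OF inf U] by blast
  define R where "R = e \<union> W"
  have "e \<inter> W = {}" using e W Q by auto
  then have R: "card R = q" "Q \<inter> R = e" "R \<inter> U = e"
    using e W r Q by (auto simp: R_def card_Un_disjoint)
  obtain A B where "switching q r U Q R A B"
    using ex_switching[OF inf r Q(1) R(1) _ U] R(2) e(2) by auto
  note AB = switchingD[OF this]
  have inQ: "S \<inter> U \<subseteq> Q" if "S \<in># add_mset R A + add_mset Q B" for S
    using AB(1)[OF that] R e by blast
  \<comment> \<open>Coverage at most 1 together with the presence of \<open>Q\<close> beside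
    \<open>B\<close> leaves no edge of \<open>Q\<close> to \<open>B\<close>; other subsets of
    \<open>U\<close> are not covered at all, because every trace on \<open>U\<close> lies in
    \<open>Q\<close>.\<close>
  have inU: "cov r (add_mset R A) f = of_bool (f \<in> Kedges r Q) \<and> cov r B f = 0" if "f \<subseteq> U" for f
  proof (cases "f \<in> Kedges r Q")
    case True
    then show ?thesis using AB(3,4)[of f] by simp
  next
    case False
    have "f \<notin> Kedges r S" if "S \<in># add_mset R A + add_mset Q B" for S
      using False inQ[OF that] \<open>f \<subseteq> U\<close> by (auto simp: Kedges_def)
    then have "cov r (add_mset R A) f = 0" "cov r (add_mset Q B) f = 0"
      by (auto simp: cov_eq_0_iff simp del: cov_simps)
    then show ?thesis using False by (simp split: if_splits)
  qed
  have B: "card (S \<inter> U) \<le> r" if "S \<in># B" for S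
  proof (rule ccontr)
    assume "\<not> ?thesis"
    then obtain f where "f \<subseteq> S \<inter> U" "card f = r"
      by (metis nat_le_linear obtain_subset_with_card_n)
    then show False using inU[of f] that by (auto simp: cov_eq_0_iff Kedges_def)
  qed
  have A: "card (S \<inter> U) \<le> r" if "S \<in># add_mset R A" for S
  proof -
    have "S \<in># add_mset R A + add_mset Q B" using that by auto
    then have "S \<inter> U \<subseteq> S \<inter> Q" using inQ by blast
    then have "card (S \<inter> U) \<le> card (S \<inter> Q)" using finQ by (intro card_mono) auto
    also have "\<dots> \<le> r" by (rule AB(2)[OF that])
    finally show ?thesis .
  qed
  \<comment> \<open>\<open>A\<close> minus \<open>B\<close> equals \<open>Q\<close> minus
    \<open>R\<close>, so moving \<open>R\<close> to the positive side represents \<open>Q\<close>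
    itself.\<close>
  show thesis
  proof (rule that[of "add_mset R A" B])
    show "card S = q \<and> card (S \<inter> U) \<le> r" if "S \<in># add_mset R A + B" for S
    proof -
      have "S \<in># add_mset R A + add_mset Q B" using that by auto
      then have "card S = q" using AB(1) by blast
      moreover have "S \<in># add_mset R A \<or> S \<in># B" using that by auto
      ultimately show ?thesis using A B by blast
    qed
    show "cov r (add_mset R A) f = cov r B f \<and> cov r (add_mset R A) f \<le> 1" if "\<not> f \<subseteq> U" for f
    proof -
      have "f \<notin> Kedges r Q" using that Q(2) by (auto simp: Kedges_def)
      then show ?thesis using AB(3)[of f] AB(4)[of f] by simp
    qed
  qed (use inU in blast)
qed

text \<open>The chain \<open>Q1\<close>, \<open>R1\<close>, \<open>R2\<close>, \<open>Q2\<close> of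
  three switchings telescopes, so \<open>A\<close> minus \<open>B\<close> equals \<open>Q1\<close>
  minus \<open>Q2\<close> as signed sums of edges, while no clique of \<open>A\<close> or
  \<open>B\<close> covers \<open>e\<close>. This removes a positive and a negative clique that share
  the old edge \<open>e\<close>.\<close>

lemma cancel:
  fixes Q1 Q2 U :: "'a set"
  assumes inf: "infinite (UNIV :: 'a set)" and r: "1 \<le> r" "r < q"
    and Q: "card Q1 = q" "Q1 \<subseteq> U" "card Q2 = q" "Q2 \<subseteq> U"
    and e: "e \<subseteq> Q1" "e \<subseteq> Q2" "card e = r" and U: "finite U"
  obtains A B where
    "\<And>S. S \<in># A + B \<Longrightarrow> card S = q"
    "\<And>f. f \<subseteq> U \<Longrightarrow> cov r A f = of_bool (f \<in> Kedges r Q1 - {e})"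
    "\<And>f. f \<subseteq> U \<Longrightarrow> cov r B f = of_bool (f \<in> Kedges r Q2 - {e})"
    "\<And>f. \<not> f \<subseteq> U \<Longrightarrow> cov r A f = cov r B f \<and> cov r A f \<le> 1"
proof -
  have fine: "finite e" using e(3) r by (auto intro: card_ge_0_finite)
  obtain W1 where W1: "finite W1" "card W1 = q - r" "W1 \<inter> U = {}"
    using obtain_fresh[OF inf U] by blast
  obtain W2 where W2: "finite W2" "card W2 = q - r" "W2 \<inter> (U \<union> W1) = {}"
    using obtain_fresh[OF inf] U W1(1) by (metis finite_UnI)
  \<comment> \<open>Fresh intermediate cliques: \<open>Q1\<close> and \<open>Q2\<close> may share more than \<open>e\<close>, and a single switching
    between them could reuse edges with ends in both.\<close>
  define R1 where "R1 = e \<union> W1"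
  define R2 where "R2 = e \<union> W2"
  have "e \<inter> W1 = {}" "e \<inter> W2 = {}" using e W1 W2 Q by auto
  then have "card R1 = q" "card R2 = q"
    using e W1 W2 r fine by (auto simp: R1_def R2_def card_Un_disjoint)
  moreover have "Q1 \<inter> R1 = e" "R1 \<inter> R2 = e" "R2 \<inter> Q2 = e"
    "R1 \<inter> U = e" "R2 \<inter> U = e"
    using e W1 W2 Q by (auto simp: R1_def R2_def)
  ultimately have R: "card R1 = q" "card R2 = q" "Q1 \<inter> R1 = e" "R1 \<inter> R2 = e" "R2 \<inter> Q2 = e"
    "R1 \<inter> U = e" "R2 \<inter> U = e" by auto
  have c: "card (Q1 \<inter> R1) = r" "card (R1 \<inter> R2) = r" "card (R2 \<inter> Q2) = r" using R e by auto
  define U1 where "U1 = U \<union> R1 \<union> R2"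
  have U1: "finite U1" using U W1 W2 fine by (simp add: U1_def R1_def R2_def)
  obtain A1 B1 where sw1: "switching q r U1 Q1 R1 A1 B1"
    using ex_switching[OF inf r Q(1) R(1) c(1) U1] by auto
  note 1 = switchingD[OF sw1]
  \<comment> \<open>Each later switching must avoid the vertices of the earlier ones except those of
    its own two cliques; hence the growing sets \<open>U1\<close>, \<open>U2\<close>,
    \<open>U3\<close>.\<close>
  define U2 where "U2 = U1 \<union> \<Union>(set_mset (add_mset R1 A1 + add_mset Q1 B1))"
  have U2: "finite U2" unfolding U2_def using U1 finite_Union_switching[OF sw1] r by simp
  obtain A2 B2 where sw2: "switching q r U2 R1 R2 A2 B2"
    using ex_switching[OF inf r R(1,2) c(2) U2] by auto
  note 2 = switchingD[OF sw2]
  define U3 where "U3 = U2 \<union> \<Union>(set_mset (add_mset R2 A2 + add_mset R1 B2))"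
  have U3: "finite U3" unfolding U3_def using U2 finite_Union_switching[OF sw2] r by simp
  obtain A3 B3 where sw3: "switching q r U3 R2 Q2 A3 B3"
    using ex_switching[OF inf r R(2) Q(3) c(3) U3] by auto
  note 3 = switchingD[OF sw3]
  \<comment> \<open>Edge multiplicities of the three switching graphs. Each graph has two
    decompositions, and \<open>H_A\<close> and \<open>H_B\<close> below express it through either
    one.\<close>
  define H1 where "H1 = cov r (add_mset R1 A1)"
  define H2 where "H2 = cov r (add_mset R2 A2)"
  define H3 where "H3 = cov r (add_mset Q2 A3)"
  have H1: "card f = r" "f \<inter> U1 \<subseteq> Q1 \<union> R1" "f \<subseteq> U2" if "H1 f > 0" for f
    using switching_cov_posD[OF sw1 that[unfolded H1_def]] unfolding U2_def by blast+
  have H2: "card f = r" "f \<inter> U2 \<subseteq> R1 \<union> R2" "f \<subseteq> U3" if "H2 f > 0" for f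
    using switching_cov_posD[OF sw2 that[unfolded H2_def]] unfolding U3_def by blast+
  have H3: "card f = r" "f \<inter> U3 \<subseteq> R2 \<union> Q2" if "H3 f > 0" for f
    using switching_cov_posD[OF sw3 that[unfolded H3_def]] by blast+
  have H_le: "H1 f \<le> 1" "H2 f \<le> 1" "H3 f \<le> 1" for f
    unfolding H1_def H2_def H3_def by (fact 1(4) 2(4) 3(4))+
  have H_A: "H1 f = cov r A1 f + of_bool (f \<in> Kedges r R1)"
    "H2 f = cov r A2 f + of_bool (f \<in> Kedges r R2)"
    "H3 f = cov r A3 f + of_bool (f \<in> Kedges r Q2)"
    and H_B: "H1 f = cov r B1 f + of_bool (f \<in> Kedges r Q1)"
    "H2 f = cov r B2 f + of_bool (f \<in> Kedges r R1)"
    "H3 f = cov r B3 f + of_bool (f \<in> Kedges r R2)" for f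
    using 1(3)[of f] 2(3)[of f] 3(3)[of f] by (auto simp: H1_def H2_def H3_def)
  have subs: "U \<subseteq> U1" "R1 \<subseteq> U1" "R2 \<subseteq> U1" "U1 \<subseteq> U2" "U2 \<subseteq> U3"
    "U \<subseteq> U2" "U \<subseteq> U3" "R2 \<subseteq> U2"
    by (auto simp: U1_def U2_def U3_def)
  show thesis
  proof (rule that[of "A1 + A2 + A3" "B1 + B2 + B3"])
    show "card S = q" if "S \<in># A1 + A2 + A3 + (B1 + B2 + B3)" for S
    proof -
      have "S \<in># add_mset R1 A1 + add_mset Q1 B1 \<or> S \<in># add_mset R2 A2 + add_mset R1 B2 \<or>
        S \<in># add_mset Q2 A3 + add_mset R2 B3"
        using that by auto
      then show ?thesis using 1(1) 2(1) 3(1) by blast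
    qed
    fix f :: "'a set"
    {
      assume f: "f \<subseteq> U"
      have fe: "card f = r \<and> f \<subseteq> e \<longleftrightarrow> f = e"
        using e(3) card_subset_eq[OF fine, of f] by auto
      have R12: "f \<in> Kedges r R1 \<longleftrightarrow> f = e" "f \<in> Kedges r R2 \<longleftrightarrow> f = e"
      proof -
        have "f \<subseteq> R1 \<longleftrightarrow> f \<subseteq> e" "f \<subseteq> R2 \<longleftrightarrow> f \<subseteq> e" using f R(6,7) by blast+
        then show "f \<in> Kedges r R1 \<longleftrightarrow> f = e" "f \<in> Kedges r R2 \<longleftrightarrow> f = e"
          using fe by (auto simp: Kedges_def)
      qed
      have eQ: "e \<in> Kedges r Q1" "e \<in> Kedges r Q2" using e by (auto simp: Kedges_def)
      have fU: "f \<inter> U1 = f" "f \<inter> U2 = f" "f \<inter> U3 = f"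
        using f subs(1,6,7) by auto
      \<comment> \<open>Inside \<open>U\<close> the three graphs reduce to the edges of
        \<open>Q1\<close>, the single edge \<open>e\<close>, and the edges of
        \<open>Q2\<close>.\<close>
      have "f \<in> Kedges r Q1" if "H1 f > 0"
      proof -
        have "f \<subseteq> Q1 \<union> (R1 \<inter> U)" using H1(2)[OF that] f unfolding fU by blast
        then show ?thesis using H1(1)[OF that] R(6) e(1) by (auto simp: Kedges_def)
      qed
      then have h1: "H1 f = of_bool (f \<in> Kedges r Q1)"
        using H_B(1)[of f] H_le(1)[of f] by (cases "f \<in> Kedges r Q1") auto
      have "f = e" if "H2 f > 0"
      proof -
        have "f \<subseteq> (R1 \<inter> U) \<union> (R2 \<inter> U)" using H2(2)[OF that] f unfolding fU by blast
        then show ?thesis using H2(1)[OF that] R(6,7) fe by simp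
      qed
      then have h2: "H2 f = of_bool (f = e)"
        using H_A(2)[of f] H_le(2)[of f] R12 by (cases "f = e") auto
      have "f \<in> Kedges r Q2" if "H3 f > 0"
      proof -
        have "f \<subseteq> (R2 \<inter> U) \<union> Q2" using H3(2)[OF that] f unfolding fU by blast
        then show ?thesis using H3(1)[OF that] R(7) e(2) by (auto simp: Kedges_def)
      qed
      then have h3: "H3 f = of_bool (f \<in> Kedges r Q2)"
        using H_A(3)[of f] H_le(3)[of f] by (cases "f \<in> Kedges r Q2") auto
      show "cov r (A1 + A2 + A3) f = of_bool (f \<in> Kedges r Q1 - {e})"
        "cov r (B1 + B2 + B3) f = of_bool (f \<in> Kedges r Q2 - {e})"
        using H_A[of f] H_B[of f] eQ unfolding h1 h2 h3 R12 by (cases "f = e"; simp)+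
    }
    assume f: "\<not> f \<subseteq> U"
    have nQ: "f \<notin> Kedges r Q1" "f \<notin> Kedges r Q2" using f Q by (auto simp: Kedges_def)
    have sub: "Q1 \<inter> R2 \<subseteq> R1" "Q2 \<inter> R1 \<subseteq> R2" "Q1 \<inter> R2 \<subseteq> U" "R1 \<inter> R2 \<subseteq> U" "R1 \<inter> Q2 \<subseteq> U"
      using Q R e by auto
    \<comment> \<open>Among edges that leave \<open>U\<close>, consecutive graphs share only edges
      of their common clique, \<open>R1\<close> or \<open>R2\<close>, and the first and third graphs
      share none.\<close>
    have "f \<in> Kedges r R1" if "H1 f > 0" "H2 f > 0"
    proof -
      have *: "f \<subseteq> R1 \<union> R2" using H1(3)[OF that(1)] H2(2)[OF that(2)] by blast
      then have "f \<subseteq> Q1 \<union> R1" using H1(2)[OF that(1)] subs(2,3) by blast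
      with * have "f \<subseteq> R1" using sub(1) by blast
      then show ?thesis using H1(1)[OF that(1)] by (simp add: Kedges_def)
    qed
    moreover have "f \<in> Kedges r R2" if "H2 f > 0" "H3 f > 0"
    proof -
      have *: "f \<subseteq> R2 \<union> Q2" using H2(3)[OF that(1)] H3(2)[OF that(2)] by blast
      moreover have "R2 \<union> Q2 \<subseteq> U2" using subs(6,8) Q(4) by auto
      ultimately have "f \<subseteq> R1 \<union> R2" using H2(2)[OF that(1)] by blast
      with * have "f \<subseteq> R2" using sub(2) by blast
      then show ?thesis using H2(1)[OF that(1)] by (simp add: Kedges_def)
    qed
    moreover have "H1 f = 0 \<or> H3 f = 0"
    proof (rule ccontr)
      assume "\<not> (H1 f = 0 \<or> H3 f = 0)"
      then have H: "H1 f > 0" "H3 f > 0" by auto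
      have *: "f \<subseteq> R2 \<union> Q2" using H1(3)[OF H(1)] H3(2)[OF H(2)] subs(5) by blast
      moreover have "R2 \<union> Q2 \<subseteq> U1" using subs(1,3) Q(4) by auto
      ultimately have "f \<subseteq> Q1 \<union> R1" using H1(2)[OF H(1)] by blast
      with * show False using f Q(2) sub(3-5) by blast
    qed
    moreover have "f \<notin> Kedges r R1 \<or> f \<notin> Kedges r R2"
      using f sub(4) unfolding Kedges_def by blast
    \<comment> \<open>Passing from the graphs to \<open>A1 + A2 + A3\<close> or
      \<open>B1 + B2 + B3\<close> subtracts \<open>R1\<close> and \<open>R2\<close> once each, which
      is exactly the slack in this bound; the third clique subtracted, \<open>Q2\<close> or
      \<open>Q1\<close>, does not cover \<open>f\<close>.\<close>
    ultimately have "H1 f + H2 f + H3 f \<le> 1 + of_bool (f \<in> Kedges r R1) + of_bool (f \<in> Kedges r R2)"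
      using H_le[of f] by (cases "H1 f = 0"; cases "H2 f = 0"; cases "H3 f = 0") simp_all
    moreover have "of_bool (f \<in> Kedges r Q1) = (0::nat)" "of_bool (f \<in> Kedges r Q2) = (0::nat)"
      using nQ by simp_all
    ultimately show "cov r (A1 + A2 + A3) f = cov r (B1 + B2 + B3) f \<and> cov r (A1 + A2 + A3) f \<le> 1"
      unfolding cov_simps using H_A[of f] H_B[of f] by (intro conjI; linarith)
  qed
qed

section \<open>Integral decompositions\<close>

definition codeg :: "nat \<Rightarrow> 'a set \<Rightarrow> ('a set \<Rightarrow> int) \<Rightarrow> 'a set \<Rightarrow> int" where
  "codeg r V \<phi> S = (\<Sum>f | f \<in> Kedges r V \<and> S \<subseteq> f. \<phi> f)"

text \<open>The lattice generated by the indicators of \<open>q\<close>-cliques. Multisets encode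
  coefficients of either sign, and the cliques are not confined to the support of
  \<open>\<phi>\<close>, since the argument uses fresh vertices.\<close>

definition clique_span :: "nat \<Rightarrow> nat \<Rightarrow> ('a set \<Rightarrow> int) \<Rightarrow> bool" where
  "clique_span q r \<phi> \<longleftrightarrow>
     (\<exists>P N. (\<forall>Q\<in>#P + N. card Q = q) \<and> (\<forall>f. \<phi> f = int (cov r P f) - int (cov r N f)))"

lemma finite_Kedges: "finite V \<Longrightarrow> finite (Kedges r V)"
  by (rule finite_subset[of _ "Pow V"]) (auto simp: Kedges_def)

lemma card_Kedges_supersets:
  assumes "finite Q" "S \<subseteq> Q" "card S \<le> r"
  shows "card {f \<in> Kedges r Q. S \<subseteq> f} = (card Q - card S) choose (r - card S)"
proof -
  have fin: "finite S" using assms by (metis finite_subset)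
  have "{f \<in> Kedges r Q. S \<subseteq> f} = (\<lambda>g. S \<union> g) ` {g. g \<subseteq> Q - S \<and> card g = r - card S}" (is "_ = ?h ` ?G")
  proof (intro set_eqI iffI)
    fix f assume f: "f \<in> {f \<in> Kedges r Q. S \<subseteq> f}"
    then have "f - S \<in> ?G" "f = S \<union> (f - S)"
      using fin by (auto simp: Kedges_def card_Diff_subset)
    then show "f \<in> ?h ` ?G" by blast
  next
    fix f assume "f \<in> ?h ` ?G"
    then obtain g where g: "f = S \<union> g" "g \<subseteq> Q - S" "card g = r - card S" by auto
    have "finite g" using g(2) assms(1) by (meson finite_Diff finite_subset)
    moreover have "S \<inter> g = {}" using g(2) by auto
    ultimately have "card f = r" using g fin assms(3) by (simp add: card_Un_disjoint)
    then show "f \<in> {f \<in> Kedges r Q. S \<subseteq> f}" using g assms(2) by (auto simp: Kedges_def)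
  qed
  moreover have "inj_on (\<lambda>g. S \<union> g) ?G" by (auto simp: inj_on_def)
  ultimately have "card {f \<in> Kedges r Q. S \<subseteq> f} = card ?G" by (simp add: card_image)
  also have "\<dots> = card (Q - S) choose (r - card S)"
    using assms(1) by (simp add: n_subsets)
  finally show ?thesis using assms fin by (simp add: card_Diff_subset)
qed

lemma codeg_diff: "codeg r V (\<lambda>f. \<phi> f - \<psi> f) S = codeg r V \<phi> S - codeg r V \<psi> S"
  by (simp add: codeg_def sum_subtractf)

lemma codeg_clique:
  assumes "finite V" "Q \<subseteq> V" "card S \<le> r"
  shows "codeg r V (\<lambda>f. of_bool (f \<in> Kedges r Q)) S =
    int ((card Q - card S) choose (r - card S)) * of_bool (S \<subseteq> Q)"
proof -
  have "codeg r V (\<lambda>f. of_bool (f \<in> Kedges r Q)) S = (\<Sum>f | f \<in> Kedges r Q \<and> S \<subseteq> f. 1)"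
    unfolding codeg_def using assms(1,2) finite_Kedges
    by (intro sum.mono_neutral_cong_right) (auto simp: Kedges_def)
  also have "\<dots> = int (card {f \<in> Kedges r Q. S \<subseteq> f})" by simp
  also have "\<dots> = int ((card Q - card S) choose (r - card S)) * of_bool (S \<subseteq> Q)"
  proof (cases "S \<subseteq> Q")
    case True
    then show ?thesis using card_Kedges_supersets[OF finite_subset[OF assms(2,1)] True assms(3)] by simp
  next
    case False
    then have empty: "{f \<in> Kedges r Q. S \<subseteq> f} = {}" by (auto simp: Kedges_def)
    show ?thesis unfolding empty using False by simp
  qed
  finally show ?thesis .
qed

text \<open>Double counting of pairs \<open>e \<subseteq> f\<close>: each \<open>f\<close> above
  \<open>T\<close> has \<open>(r - card T) choose (i - card T)\<close> sets \<open>e\<close> of size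
  \<open>i\<close> between \<open>T\<close> and itself.\<close>

lemma sum_codeg:
  assumes "finite V" "card T \<le> i"
  shows "(\<Sum>e | e \<in> Kedges i V \<and> T \<subseteq> e. codeg r V \<phi> e) =
    int ((r - card T) choose (i - card T)) * codeg r V \<phi> T"
proof -
  have "(\<Sum>e | e \<in> Kedges i V \<and> T \<subseteq> e. codeg r V \<phi> e) =
      (\<Sum>f\<in>Kedges r V. \<Sum>e | e \<in> {e \<in> Kedges i V. T \<subseteq> e} \<and> e \<subseteq> f. \<phi> f)"
    unfolding codeg_def using assms(1) finite_Kedges
    by (subst sum.swap_restrict[symmetric]) auto
  also have "\<dots> = (\<Sum>f\<in>Kedges r V. if T \<subseteq> f then int ((r - card T) choose (i - card T)) * \<phi> f else 0)"
  proof (intro sum.cong refl)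
    fix f assume f: "f \<in> Kedges r V"
    show "(\<Sum>e | e \<in> {e \<in> Kedges i V. T \<subseteq> e} \<and> e \<subseteq> f. \<phi> f) =
      (if T \<subseteq> f then int ((r - card T) choose (i - card T)) * \<phi> f else 0)"
    proof (cases "T \<subseteq> f")
      case True
      have "{e. e \<in> {e \<in> Kedges i V. T \<subseteq> e} \<and> e \<subseteq> f} = {e \<in> Kedges i f. T \<subseteq> e}"
        using f by (auto simp: Kedges_def)
      moreover have "finite f" "card f = r" using f assms(1) by (auto simp: Kedges_def finite_subset)
      ultimately show ?thesis using True card_Kedges_supersets[of f T i] assms(2) by simp
    next
      case False
      then have empty: "{e. e \<in> {e \<in> Kedges i V. T \<subseteq> e} \<and> e \<subseteq> f} = {}" by auto
      show ?thesis unfolding empty using False by simp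
    qed
  qed
  also have "\<dots> = int ((r - card T) choose (i - card T)) * codeg r V \<phi> T"
    unfolding codeg_def sum_distrib_left
    by (simp add: sum.inter_filter[OF finite_Kedges[OF assms(1)]])
  finally show ?thesis .
qed

lemma clique_span_scale:
  assumes "card Q = q"
  shows "clique_span q r (\<lambda>f. c * of_bool (f \<in> Kedges r Q))"
proof -
  have "cov r (replicate_mset n Q) f = n * of_bool (f \<in> Kedges r Q)" for n f
    by (induction n) auto
  \<comment> \<open>At least one of \<open>nat c\<close> and \<open>nat (- c)\<close> is 0, and
    their difference is \<open>c\<close>.\<close>
  then show ?thesis unfolding clique_span_def
    using assms by (intro exI[of _ "replicate_mset (nat c) Q"] exI[of _ "replicate_mset (nat (- c)) Q"])
      (auto split: if_splits)
qed

lemma clique_span_add: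
  assumes "clique_span q r \<phi>" "clique_span q r \<psi>"
  shows "clique_span q r (\<lambda>f. \<phi> f + \<psi> f)"
proof -
  obtain P N P' N' where "\<forall>Q\<in>#P + N. card Q = q" "\<forall>f. \<phi> f = int (cov r P f) - int (cov r N f)"
    "\<forall>Q\<in>#P' + N'. card Q = q" "\<forall>f. \<psi> f = int (cov r P' f) - int (cov r N' f)"
    using assms unfolding clique_span_def by blast
  then show ?thesis unfolding clique_span_def
    by (intro exI[of _ "P + P'"] exI[of _ "N + N'"]) auto
qed

lemma clique_span_sum:
  assumes "\<And>e. e \<in> I \<Longrightarrow> clique_span q r (\<phi> e)"
  shows "clique_span q r (\<lambda>f. \<Sum>e\<in>I. \<phi> e f)"
proof -
  have "clique_span q r (\<lambda>f. 0)"
    unfolding clique_span_def by (intro exI[of _ "{#}"]) auto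
  then show ?thesis using assms
    by (induction I rule: infinite_finite_induct) (auto intro!: clique_span_add)
qed

text \<open>Induction on how far the size \<open>i\<close>, below which all degrees vanish, is from
  \<open>r + 1\<close>. Every round subtracts cliques, so the divisibility conditions persist, and
  adds fresh vertices, which is why \<open>V\<close> is generalised.\<close>

lemma clique_span_if_divisible_aux:
  fixes \<phi> :: "'a set \<Rightarrow> int"
  assumes inf: "infinite (UNIV :: 'a set)" and "r < q" "finite V" "i \<le> Suc r"
    and "\<And>f. f \<notin> Kedges r V \<Longrightarrow> \<phi> f = 0"
    and "\<And>S. card S < i \<Longrightarrow> codeg r V \<phi> S = 0"
    and "\<And>S. card S \<le> r \<Longrightarrow> int ((q - card S) choose (r - card S)) dvd codeg r V \<phi> S"
  shows "clique_span q r \<phi>"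
  using assms(3-)
proof (induction "Suc r - i" arbitrary: i V \<phi>)
  case 0
  \<comment> \<open>Here \<open>i = r + 1\<close>, and the degree of an \<open>r\<close>-set in
    \<open>V\<close> is its own weight.\<close>
  have "\<phi> f = 0" for f
  proof (cases "f \<in> Kedges r V")
    case True
    then have "{g. g \<in> Kedges r V \<and> f \<subseteq> g} = {f}"
      using \<open>finite V\<close> by (auto simp: Kedges_def dest: card_subset_eq[rotated] finite_subset)
    then have "codeg r V \<phi> f = \<phi> f" by (simp add: codeg_def)
    then show ?thesis using "0.prems"(4)[of f] "0.hyps" True by (simp add: Kedges_def)
  qed (use "0.prems" in simp)
  then show ?case using clique_span_sum[of "{}" q r "\<lambda>_. \<phi>"] by (simp add: fun_eq_iff)
next
  case (Suc n)
  note finV = Suc.prems(1) and supp = Suc.prems(3) and zero = Suc.prems(4) and dvd = Suc.prems(5)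
  have ir: "i \<le> r" using Suc.hyps(2) by simp
  obtain W where W: "finite W" "card W = q - i" "W \<inter> V = {}"
    using obtain_fresh[OF inf finV] by blast
  define C where "C = int ((q - i) choose (r - i))"
  define d where "d e = codeg r V \<phi> e div C" for e
  have "C \<noteq> 0" using \<open>r < q\<close> ir by (simp add: C_def)
  have Cd: "C * d e = codeg r V \<phi> e" if "e \<in> Kedges i V" for e
    using dvd[of e] that ir by (simp add: C_def d_def Kedges_def)
  \<comment> \<open>One \<open>W\<close> serves all \<open>e\<close>: whether a set
    \<open>S \<subseteq> V \<union> W\<close> lies in \<open>e \<union> W\<close> then depends on
    \<open>S \<inter> V\<close> only.\<close>
  define \<psi> where "\<psi> f = (\<Sum>e\<in>Kedges i V. d e * of_bool (f \<in> Kedges r (e \<union> W)))" for f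
  have eW: "card (e \<union> W) = q" "e \<union> W \<subseteq> V \<union> W" if "e \<in> Kedges i V" for e
  proof -
    have "finite e" "e \<inter> W = {}" using that finV W(3) by (auto simp: Kedges_def finite_subset)
    then show "card (e \<union> W) = q" using that W ir \<open>r < q\<close> by (simp add: card_Un_disjoint Kedges_def)
    show "e \<union> W \<subseteq> V \<union> W" using that by (auto simp: Kedges_def)
  qed
  have span: "clique_span q r \<psi>"
    unfolding \<psi>_def using eW(1) by (intro clique_span_sum clique_span_scale)
  define U where "U = V \<union> W"
  have finU: "finite U" using finV W by (simp add: U_def)
  have codeg_U: "codeg r U \<phi> S = codeg r V \<phi> S" for S
    unfolding codeg_def using finU finite_Kedges supp
    by (intro sum.mono_neutral_right) (auto simp: U_def Kedges_def)
  have codeg_\<psi>: "codeg r U \<psi> S =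
      int ((q - card S) choose (r - card S)) * (\<Sum>e | e \<in> Kedges i V \<and> S \<subseteq> e \<union> W. d e)"
    if "card S \<le> r" for S
  proof -
    have "codeg r U \<psi> S = (\<Sum>e\<in>Kedges i V. d e * codeg r U (\<lambda>f. of_bool (f \<in> Kedges r (e \<union> W))) S)"
      unfolding codeg_def \<psi>_def sum_distrib_left by (rule sum.swap)
    also have "\<dots> = (\<Sum>e\<in>Kedges i V. int ((q - card S) choose (r - card S)) * (if S \<subseteq> e \<union> W then d e else 0))"
      using codeg_clique[OF finU _ that] eW by (intro sum.cong) (auto simp: U_def)
    also have "\<dots> = int ((q - card S) choose (r - card S)) * (\<Sum>e | e \<in> Kedges i V \<and> S \<subseteq> e \<union> W. d e)"
      by (simp add: sum_distrib_left[symmetric] sum.inter_filter[OF finite_Kedges[OF finV]])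
    finally show ?thesis .
  qed
  \<comment> \<open>By \<open>sum_codeg\<close> the sum of the degrees of the \<open>i\<close>-sets
    above \<open>T\<close> is a multiple of the degree of \<open>T\<close>, which vanishes; division
    by the nonzero \<open>C\<close> keeps it 0.\<close>
  have null: "(\<Sum>e | e \<in> Kedges i V \<and> T \<subseteq> e. d e) = 0" if "card T < i" for T
  proof -
    have "C * (\<Sum>e | e \<in> Kedges i V \<and> T \<subseteq> e. d e) = (\<Sum>e | e \<in> Kedges i V \<and> T \<subseteq> e. codeg r V \<phi> e)"
      using Cd by (simp add: sum_distrib_left)
    also have "\<dots> = 0" using sum_codeg[OF finV, of T i r \<phi>] zero[OF that] that by simp
    finally show ?thesis using \<open>C \<noteq> 0\<close> by simp
  qed
  have codeg_0: "codeg r U (\<lambda>f. \<phi> f - \<psi> f) S = 0" if S: "card S < Suc i" for S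
  proof (cases "S \<subseteq> U")
    case False
    \<comment> \<open>This case also takes the infinite \<open>S\<close>, whose \<open>card\<close>
      is 0.\<close>
    then have empty: "{f. f \<in> Kedges r U \<and> S \<subseteq> f} = {}" by (auto simp: Kedges_def)
    show ?thesis unfolding codeg_def empty by simp
  next
    case True
    have finS: "finite S" using True finU finite_subset by blast
    have eq: "{e. e \<in> Kedges i V \<and> S \<subseteq> e \<union> W} = {e. e \<in> Kedges i V \<and> S \<inter> V \<subseteq> e}"
      using True W(3) by (auto simp: U_def Kedges_def)
    have S': "card S \<le> r" using S ir by simp
    \<comment> \<open>With fewer than \<open>i\<close> vertices of \<open>S\<close> in
      \<open>V\<close> the degrees of \<open>\<phi>\<close> and \<open>\<psi>\<close> both vanish;
      otherwise \<open>S\<close> is an \<open>i\<close>-subset of \<open>V\<close>, only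
      \<open>e = S\<close> contributes, and \<open>C * d S\<close> cancels the degree.\<close>
    show ?thesis
    proof (cases "card (S \<inter> V) < i")
      case True
      have "codeg r V \<phi> S = 0"
      proof (cases "S \<subseteq> V")
        case True
        then have "S \<inter> V = S" by auto
        then show ?thesis using zero[of S] \<open>card (S \<inter> V) < i\<close> by simp
      next
        case False
        then have empty: "{f. f \<in> Kedges r V \<and> S \<subseteq> f} = {}" by (auto simp: Kedges_def)
        show ?thesis unfolding codeg_def empty by simp
      qed
      then show ?thesis using null[OF True] by (simp add: codeg_diff codeg_U codeg_\<psi>[OF S'] eq)
    next
      case False
      then have "card S = i" "S \<inter> V = S"
        using S card_mono[OF finS, of "S \<inter> V"] card_subset_eq[OF finS, of "S \<inter> V"] by auto
      then have "S \<in> Kedges i V" by (auto simp: Kedges_def)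
      moreover have "{e. e \<in> Kedges i V \<and> S \<subseteq> e} = {S}"
      proof -
        have "e = S" if "e \<in> Kedges i V" "S \<subseteq> e" for e
        proof -
          have "finite e" "card e = card S"
            using that \<open>card S = i\<close> finV by (auto simp: Kedges_def finite_subset)
          then show ?thesis using that(2) card_subset_eq[of e S] by simp
        qed
        then show ?thesis using \<open>S \<in> Kedges i V\<close> by auto
      qed
      ultimately show ?thesis
        using Cd[of S] \<open>card S = i\<close> \<open>S \<inter> V = S\<close>
        by (simp add: codeg_diff codeg_U codeg_\<psi>[OF S'] eq C_def)
    qed
  qed
  have "clique_span q r (\<lambda>f. \<phi> f - \<psi> f)"
  proof (rule Suc.hyps(1)[of "Suc i" U])
    show "n = Suc r - Suc i" "Suc i \<le> Suc r" using Suc.hyps(2) ir by auto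
    show "finite U" by (fact finU)
    show "\<phi> f - \<psi> f = 0" if "f \<notin> Kedges r U" for f
    proof -
      have "f \<notin> Kedges r V" using that by (auto simp: Kedges_def U_def)
      moreover have "f \<notin> Kedges r (e \<union> W)" if "e \<in> Kedges i V" for e
        using \<open>f \<notin> Kedges r U\<close> eW(2)[OF that] unfolding Kedges_def U_def by blast
      ultimately show ?thesis using supp by (simp add: \<psi>_def)
    qed
    show "codeg r U (\<lambda>f. \<phi> f - \<psi> f) S = 0" if "card S < Suc i" for S
      using codeg_0 that .
    show "int ((q - card S) choose (r - card S)) dvd codeg r U (\<lambda>f. \<phi> f - \<psi> f) S"
      if "card S \<le> r" for S
      unfolding codeg_diff codeg_U codeg_\<psi>[OF that] using dvd[OF that] by (intro dvd_diff) auto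
  qed
  from clique_span_add[OF this span] show ?case by simp
qed

lemma clique_span_if_divisible:
  fixes \<phi> :: "'a set \<Rightarrow> int"
  assumes "infinite (UNIV :: 'a set)" "r < q" "finite V"
    and "\<And>f. f \<notin> Kedges r V \<Longrightarrow> \<phi> f = 0"
    and "\<And>S. card S \<le> r \<Longrightarrow> int ((q - card S) choose (r - card S)) dvd codeg r V \<phi> S"
  shows "clique_span q r \<phi>"
  using assms by (intro clique_span_if_divisible_aux[of r q V 0]) auto

section \<open>From signed cliques to an absorber\<close>

text \<open>\<open>V\<close> holds the old vertices. The bound
  \<open>card (Q \<inter> V) \<le> r\<close> allows each clique at most one edge inside
  \<open>V\<close>. By the last clause both signs cover the same edges that leave \<open>V\<close>,
  each once, so only edges inside \<open>V\<close> remain to be repaired.\<close>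

definition realises ::
    "nat \<Rightarrow> nat \<Rightarrow> 'a set \<Rightarrow> ('a set \<Rightarrow> int) \<Rightarrow> 'a set multiset \<Rightarrow> 'a set multiset \<Rightarrow> bool" where
  "realises q r V \<phi> P N \<longleftrightarrow>
     (\<forall>Q\<in>#P + N. card Q = q \<and> card (Q \<inter> V) \<le> r) \<and>
     (\<forall>f\<subseteq>V. \<phi> f = int (cov r P f) - int (cov r N f)) \<and>
     (\<forall>f. \<not> f \<subseteq> V \<longrightarrow> cov r P f = cov r N f \<and> cov r P f \<le> 1)"

lemma realises_uminus: "realises q r V \<phi> P N \<Longrightarrow> realises q r V (\<lambda>f. - \<phi> f) N P"
  unfolding realises_def by (auto simp: Un_commute)

text \<open>\<open>boost\<close> is applied to a set \<open>U\<close> containing all vertices in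
  use: inside \<open>U\<close> the new cliques cover only edges of \<open>Q\<close>, and outside it
  the old ones cover nothing. An edge that leaves \<open>V\<close> is thus never covered by both old
  and new cliques.\<close>

lemma realises_add_clique:
  fixes V :: "'a set"
  assumes inf: "infinite (UNIV :: 'a set)" and r: "1 \<le> r" "r < q" and V: "finite V"
    and Q: "card Q = q" "Q \<subseteq> V" and PN: "realises q r V \<phi> P N"
  shows "\<exists>P' N'. realises q r V (\<lambda>f. \<phi> f + of_bool (f \<in> Kedges r Q)) P' N'"
proof -
  define U where "U = V \<union> \<Union>(set_mset (P + N))"
  have cards: "card S = q" if "S \<in># P + N" for S
    using PN that unfolding realises_def by blast
  have finU: "finite U" unfolding U_def
  proof (intro finite_UnI V finite_Union)
    show "finite S" if "S \<in> set_mset (P + N)" for S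
      using cards[OF that] r card_ge_0_finite[of S] by linarith
  qed simp
  obtain A B where AB: "\<And>S. S \<in># A + B \<Longrightarrow> card S = q \<and> card (S \<inter> U) \<le> r"
    "\<And>f. f \<subseteq> U \<Longrightarrow> cov r A f = of_bool (f \<in> Kedges r Q) \<and> cov r B f = 0"
    "\<And>f. \<not> f \<subseteq> U \<Longrightarrow> cov r A f = cov r B f \<and> cov r A f \<le> 1"
    using boost[OF inf r Q(1) _ finU] Q(2) unfolding U_def by blast
  have outside: "cov r P f = 0" "cov r N f = 0" if "\<not> f \<subseteq> U" for f
    using that unfolding cov_eq_0_iff U_def Kedges_def by auto
  have "realises q r V (\<lambda>f. \<phi> f + of_bool (f \<in> Kedges r Q)) (P + A) (N + B)"
    unfolding realises_def
  proof (intro conjI ballI allI impI)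
    fix S assume S: "S \<in># P + A + (N + B)"
    then consider "S \<in># P + N" | "S \<in># A + B" by auto
    then have "card S = q \<and> card (S \<inter> V) \<le> r"
    proof cases
      case 1
      then show ?thesis using PN unfolding realises_def by blast
    next
      case 2
      have "S \<inter> V \<subseteq> S \<inter> U" by (auto simp: U_def)
      then have "card (S \<inter> V) \<le> card (S \<inter> U)" using finU by (intro card_mono) auto
      then show ?thesis using AB(1)[OF 2] by simp
    qed
    then show "card S = q" "card (S \<inter> V) \<le> r" by auto
  next
    fix f assume f: "f \<subseteq> V"
    then have "f \<subseteq> U" by (auto simp: U_def)
    moreover have "\<phi> f = int (cov r P f) - int (cov r N f)"
      using PN f unfolding realises_def by blast
    ultimately show "\<phi> f + of_bool (f \<in> Kedges r Q) = int (cov r (P + A) f) - int (cov r (N + B) f)"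
      using AB(2)[of f] by simp
  next
    fix f assume f: "\<not> f \<subseteq> V"
    have PN': "cov r P f = cov r N f" "cov r P f \<le> 1"
      using PN f unfolding realises_def by blast+
    have Qf: "f \<notin> Kedges r Q" using Q f by (auto simp: Kedges_def)
    show "cov r (P + A) f = cov r (N + B) f" "cov r (P + A) f \<le> 1"
      using PN' Qf AB(2,3)[of f] outside[of f] by (cases "f \<subseteq> U"; simp)+
  qed
  then show ?thesis by blast
qed

lemma ex_realises_cov:
  fixes V :: "'a set"
  assumes "infinite (UNIV :: 'a set)" "1 \<le> r" "r < q" "finite V"
    and "\<forall>Q\<in>#M. card Q = q \<and> Q \<subseteq> V" "realises q r V \<phi> P N"
  shows "\<exists>P' N'. realises q r V (\<lambda>f. \<phi> f + int (cov r M f)) P' N'"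
  using assms(5)
proof (induction M)
  case empty
  show ?case using assms(6) by auto
next
  case (add Q M)
  then obtain P' N' where "realises q r V (\<lambda>f. \<phi> f + int (cov r M f)) P' N'" by auto
  from realises_add_clique[OF assms(1-4) _ _ this, of Q] add.prems
  obtain P'' N'' where "realises q r V (\<lambda>f. \<phi> f + int (cov r M f) + of_bool (f \<in> Kedges r Q)) P'' N''"
    by auto
  moreover have "(\<lambda>f. \<phi> f + int (cov r M f) + of_bool (f \<in> Kedges r Q)) =
      (\<lambda>f. \<phi> f + int (cov r (add_mset Q M) f))"
    by (auto simp: fun_eq_iff)
  ultimately show ?case by auto
qed

lemma ex_realises:
  fixes V :: "'a set"
  assumes "infinite (UNIV :: 'a set)" "1 \<le> r" "r < q" "finite V"
    and "\<forall>Q\<in>#P + N. card Q = q \<and> Q \<subseteq> V"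
  shows "\<exists>P' N'. realises q r V (\<lambda>f. int (cov r P f) - int (cov r N f)) P' N'"
proof -
  have P: "\<forall>Q\<in>#P. card Q = q \<and> Q \<subseteq> V" and N: "\<forall>Q\<in>#N. card Q = q \<and> Q \<subseteq> V"
    using assms(5) by auto
  \<comment> \<open>The negative cliques are inserted first, as positive ones; exchanging the two
    multisets then gives them their sign.\<close>
  have "realises q r V (\<lambda>f. 0) {#} {#}" by (simp add: realises_def)
  from ex_realises_cov[OF assms(1-4) N this]
  obtain P1 N1 where "realises q r V (\<lambda>f. 0 + int (cov r N f)) P1 N1" by blast
  from realises_uminus[OF this] have "realises q r V (\<lambda>f. - int (cov r N f)) N1 P1" by simp
  from ex_realises_cov[OF assms(1-4) P this] show ?thesis by simp
qed

text \<open>Since \<open>\<phi>\<close> is nonnegative at the edge \<open>e = Q2 \<inter> V\<close>,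
  some positive clique covers \<open>e\<close> as well. Both cliques meet \<open>V\<close> exactly
  in \<open>e\<close>, so \<open>cancel\<close> removes them without creating an edge inside
  \<open>V\<close>.\<close>

lemma realises_cancel:
  fixes V :: "'a set"
  assumes inf: "infinite (UNIV :: 'a set)" and r: "1 \<le> r" "r < q" and V: "finite V"
    and PN: "realises q r V \<phi> P N"
    and Q2: "Q2 \<in># N" "card (Q2 \<inter> V) = r" and nonneg: "0 \<le> \<phi> (Q2 \<inter> V)"
  shows "\<exists>P' B. realises q r V \<phi> P' (N - {#Q2#} + B) \<and> (\<forall>S\<in>#B. card (S \<inter> V) \<noteq> r)"
proof -
  define e where "e = Q2 \<inter> V"
  have cards: "card S = q" "card (S \<inter> V) \<le> r" "finite S" if "S \<in># P + N" for S
    using PN that r card_ge_0_finite[of S] unfolding realises_def by auto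
  have eK: "e \<in> Kedges r Q2" using Q2 by (auto simp: e_def Kedges_def)
  then have "0 < cov r N e" using Q2(1) unfolding cov_pos_iff by blast
  moreover have "\<phi> e = int (cov r P e) - int (cov r N e)"
    using PN unfolding realises_def e_def by blast
  ultimately have "0 < cov r P e" using nonneg unfolding e_def by linarith
  then obtain Q1 where Q1: "Q1 \<in># P" "e \<in> Kedges r Q1" unfolding cov_pos_iff by blast
  have Q1P: "Q1 \<in># P + N" and Q2P: "Q2 \<in># P + N" using Q1(1) Q2(1) by auto
  have e_Q1: "Q1 \<inter> V = e"
  proof -
    have "e \<subseteq> Q1 \<inter> V" "card e = r" using Q1(2) by (auto simp: Kedges_def e_def)
    then show ?thesis using cards[OF Q1P] card_seteq[of "Q1 \<inter> V" e] by simp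
  qed
  define U where "U = V \<union> \<Union>(set_mset (P + N))"
  have finU: "finite U" using V cards(3) unfolding U_def by auto
  have QU: "Q1 \<subseteq> U" "Q2 \<subseteq> U" using Q1P Q2P unfolding U_def by blast+
  have eQ: "e \<subseteq> Q1" "e \<subseteq> Q2" "card e = r" using Q1(2) eK by (auto simp: Kedges_def)
  obtain A B where AB: "\<And>S. S \<in># A + B \<Longrightarrow> card S = q"
    "\<And>f. f \<subseteq> U \<Longrightarrow> cov r A f = of_bool (f \<in> Kedges r Q1 - {e})"
    "\<And>f. f \<subseteq> U \<Longrightarrow> cov r B f = of_bool (f \<in> Kedges r Q2 - {e})"
    "\<And>f. \<not> f \<subseteq> U \<Longrightarrow> cov r A f = cov r B f \<and> cov r A f \<le> 1"
    using cancel[OF inf r cards(1)[OF Q1P] QU(1) cards(1)[OF Q2P] QU(2) eQ finU] by blast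
  have fe: "f = e" if "f \<in> Kedges r Q1 \<or> f \<in> Kedges r Q2" "f \<subseteq> V" for f
  proof -
    have "f \<subseteq> e" "card f = card e" using that e_Q1 e_def eQ(3) by (auto simp: Kedges_def)
    moreover have "finite e" using V by (simp add: e_def)
    ultimately show ?thesis by (intro card_subset_eq)
  qed
  have inV: "cov r A f = 0" "cov r B f = 0" if "f \<subseteq> V" for f
  proof -
    have "f \<subseteq> U" using that by (auto simp: U_def)
    then show "cov r A f = 0" "cov r B f = 0" using AB(2,3)[of f] fe[OF _ that] by auto
  qed
  have newV: "card (S \<inter> V) < r" if S: "S \<in># A + B" for S
  proof (rule ccontr)
    assume "\<not> card (S \<inter> V) < r"
    then have "r \<le> card (S \<inter> V)" by simp
    then obtain f where f: "f \<subseteq> S \<inter> V" "card f = r"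
      using obtain_subset_with_card_n by metis
    then have "f \<in> Kedges r S" "f \<subseteq> V" by (auto simp: Kedges_def)
    then show False using inV[of f] S unfolding cov_eq_0_iff by auto
  qed
  define P' where "P' = P - {#Q1#}"
  define N' where "N' = N - {#Q2#}"
  have P: "P = add_mset Q1 P'" and N: "N = add_mset Q2 N'"
    using Q1(1) Q2(1) by (simp_all add: P'_def N'_def)
  have "realises q r V \<phi> (P' + A) (N' + B)"
    unfolding realises_def
  proof (intro conjI ballI allI impI)
    fix S assume "S \<in># P' + A + (N' + B)"
    then consider "S \<in># P + N" | "S \<in># A + B" by (auto simp: P N)
    then have "card S = q \<and> card (S \<inter> V) \<le> r"
      by cases (use cards AB(1) newV in \<open>auto simp: less_imp_le\<close>)
    then show "card S = q" "card (S \<inter> V) \<le> r" by auto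
  next
    fix f assume f: "f \<subseteq> V"
    have "f \<in> Kedges r Q1 \<longleftrightarrow> f \<in> Kedges r Q2" using fe[OF _ f] eK Q1(2) by blast
    moreover have "\<phi> f = int (cov r P f) - int (cov r N f)"
      using PN f unfolding realises_def by blast
    ultimately show "\<phi> f = int (cov r (P' + A) f) - int (cov r (N' + B) f)"
      using inV[OF f] by (simp add: P N split: if_splits)
  next
    fix f assume f: "\<not> f \<subseteq> V"
    have PN': "cov r P f = cov r N f" "cov r P f \<le> 1"
      using PN f unfolding realises_def by blast+
    have "f \<noteq> e" using f by (auto simp: e_def)
    have "cov r (P' + A) f = cov r (N' + B) f \<and> cov r (P' + A) f \<le> 1"
    proof (cases "f \<subseteq> U")
      case True
      \<comment> \<open>Inside \<open>U\<close> the new cliques restore every edge of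
        \<open>Q1\<close> and \<open>Q2\<close> except \<open>e\<close>, which lies in
        \<open>V\<close>.\<close>
      have "cov r (P' + A) f = cov r P f" "cov r (N' + B) f = cov r N f"
        using AB(2,3)[OF True] \<open>f \<noteq> e\<close> by (simp_all add: P N)
      then show ?thesis using PN' by simp
    next
      case False
      then have "cov r P f = 0" "cov r N f = 0"
        unfolding cov_eq_0_iff U_def Kedges_def by auto
      then have "cov r P' f = 0" "cov r N' f = 0" by (simp_all add: P N split: if_splits)
      then show ?thesis using AB(4)[OF False] by simp
    qed
    then show "cov r (P' + A) f = cov r (N' + B) f" "cov r (P' + A) f \<le> 1" by auto
  qed
  moreover have "\<forall>S\<in>#B. card (S \<inter> V) \<noteq> r" using newV by force
  ultimately show ?thesis unfolding N'_def by blast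
qed

text \<open>Each use of \<open>realises_cancel\<close> lowers by one the number of negative cliques
  with an edge inside \<open>V\<close>, because none of the new negative cliques has one.\<close>

lemma ex_realises_no_negative:
  fixes V :: "'a set"
  assumes "infinite (UNIV :: 'a set)" "1 \<le> r" "r < q" "finite V"
    and "realises q r V \<phi> P N" and nonneg: "\<And>f. 0 \<le> \<phi> f"
  shows "\<exists>P' N'. realises q r V \<phi> P' N' \<and> (\<forall>S\<in>#N'. card (S \<inter> V) \<noteq> r)"
  using assms(5)
proof (induction "size {#S \<in># N. card (S \<inter> V) = r#}" arbitrary: P N)
  case 0
  then have "\<forall>S\<in>#N. card (S \<inter> V) \<noteq> r" by (auto simp: filter_mset_eq_conv)
  then show ?case using "0.prems" by blast
next
  case (Suc n)
  have "{#S \<in># N. card (S \<inter> V) = r#} \<noteq> {#}"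
  proof
    assume "{#S \<in># N. card (S \<inter> V) = r#} = {#}"
    with Suc.hyps(2) show False by simp
  qed
  then obtain Q where "Q \<in># {#S \<in># N. card (S \<inter> V) = r#}" by (rule multiset_nonemptyE)
  then have Q: "Q \<in># N" "card (Q \<inter> V) = r" by simp_all
  then obtain N0 where N: "N = add_mset Q N0" by (meson mset_add)
  obtain P' B where *: "realises q r V \<phi> P' (N0 + B)" "\<forall>S\<in>#B. card (S \<inter> V) \<noteq> r"
    using realises_cancel[OF assms(1-4) Suc.prems Q nonneg] unfolding N by auto
  have "{#S \<in># B. card (S \<inter> V) = r#} = {#}" using *(2) by (induction B) auto
  then have "n = size {#S \<in># N0 + B. card (S \<inter> V) = r#}"
    using Suc.hyps(2) Q(2) unfolding N by simp
  from Suc.hyps(1)[OF this *(1)] show ?case .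
qed

section \<open>Assembling the absorber\<close>

lemma has_decomposition_if_cov_le_1:
  assumes "\<And>Q. Q \<in># M \<Longrightarrow> Q \<subseteq> V \<and> finite Q \<and> card Q = q" "\<And>f. cov r M f \<le> 1"
  shows "has_Kqr_decomposition q r V {f. 0 < cov r M f}"
  unfolding has_Kqr_decomposition_def
proof (intro exI[of _ "set_mset M"] conjI ballI impI)
  fix Q1 Q2 assume Q: "Q1 \<in># M" "Q2 \<in># M" "Q1 \<noteq> Q2"
  show "Kedges r Q1 \<inter> Kedges r Q2 = {}"
  proof (rule ccontr)
    assume "Kedges r Q1 \<inter> Kedges r Q2 \<noteq> {}"
    then obtain f where f: "f \<in> Kedges r Q1" "f \<in> Kedges r Q2" by blast
    obtain M' where "M = add_mset Q1 (add_mset Q2 M')"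
      using Q by (metis insert_noteq_member mset_add)
    then have "2 \<le> cov r M f" using f by simp
    then show False using assms(2)[of f] by simp
  qed
qed (use assms(1) in \<open>auto simp: cov_pos_iff\<close>)

text \<open>The vertex type is taken to be infinite because the constructions draw fresh vertices
  from it.\<close>

theorem theorem1p2:
  fixes q r :: nat and VL :: "'a set" and EL :: "'a set set"
  assumes "infinite (UNIV :: 'a set)"
    and "1 \<le> r" and "r < q"
    and "rgraph r VL EL"
    and "Kqr_divisible q r VL EL"
  shows "\<exists>VA EA. rgraph r VA EA \<and> Kqr_absorber q r VL EL VA EA"
proof -
  define \<phi> where "\<phi> f = (of_bool (f \<in> EL) :: int)" for f
  have VL: "finite VL" and EL: "f \<in> EL \<Longrightarrow> f \<subseteq> VL \<and> card f = r" for f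
    using assms(4) by (auto simp: rgraph_def)
  have "EL \<subseteq> Pow VL" using EL by blast
  then have finEL: "finite EL" using VL finite_subset by blast
  have codeg: "codeg r VL \<phi> S = int (card {e \<in> EL. S \<subseteq> e})" for S
  proof -
    have "codeg r VL \<phi> S = (\<Sum>f | f \<in> EL \<and> S \<subseteq> f. 1)"
      unfolding codeg_def \<phi>_def
    proof (rule sum.mono_neutral_cong_right)
      show "finite {f. f \<in> Kedges r VL \<and> S \<subseteq> f}"
        by (rule finite_subset[OF _ finite_Kedges[OF VL]]) auto
    qed (use EL in \<open>auto simp: Kedges_def\<close>)
    then show ?thesis by simp
  qed
  have "clique_span q r \<phi>"
  proof (rule clique_span_if_divisible[OF assms(1,3) VL])
    show "\<phi> f = 0" if "f \<notin> Kedges r VL" for f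
      using that EL by (auto simp: \<phi>_def Kedges_def)
    fix S :: "'a set" assume S: "card S \<le> r"
    show "int ((q - card S) choose (r - card S)) dvd codeg r VL \<phi> S"
    \<comment> \<open>Divisibility is assumed only for sets of fewer than \<open>r\<close> vertices;
      at \<open>card S = r\<close> the binomial coefficient is 1, and sets not contained in
      \<open>VL\<close> lie in no edge.\<close>
    proof (cases "S \<subseteq> VL \<and> card S < r")
      case True
      then show ?thesis using assms(5) unfolding codeg Kqr_divisible_def by auto
    next
      case False
      then consider "\<not> S \<subseteq> VL" | "card S = r" using S by linarith
      then show ?thesis
      proof cases
        case 1
        then have empty: "{e \<in> EL. S \<subseteq> e} = {}" using EL by blast
        show ?thesis unfolding codeg empty by simp
      qed simp
    qed
  qed
  then obtain P N where PN: "\<forall>Q\<in>#P + N. card Q = q"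
    "\<And>f. \<phi> f = int (cov r P f) - int (cov r N f)"
    unfolding clique_span_def by blast
  have finQ: "finite Q" if "card Q = q" for Q :: "'a set"
    using that assms(3) card_ge_0_finite[of Q] by linarith
  define V where "V = VL \<union> \<Union>(set_mset (P + N))"
  have V: "finite V" "VL \<subseteq> V" unfolding V_def using VL PN(1) finQ by auto
  have "\<forall>Q\<in>#P + N. card Q = q \<and> Q \<subseteq> V" using PN(1) unfolding V_def by blast
  from ex_realises[OF assms(1-3) V(1) this] obtain P1 N1 where "realises q r V \<phi> P1 N1"
    unfolding PN(2)[symmetric] by blast
  moreover have "0 \<le> \<phi> f" for f by (simp add: \<phi>_def)
  ultimately obtain P2 N2 where R: "realises q r V \<phi> P2 N2" and noV: "\<forall>S\<in>#N2. card (S \<inter> V) \<noteq> r"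
    using ex_realises_no_negative[OF assms(1-3) V(1)] by metis
  have card2: "card Q = q" "card (Q \<inter> V) \<le> r" if "Q \<in># P2 + N2" for Q
    using R that unfolding realises_def by blast+
  \<comment> \<open>For a negative clique \<open>S\<close>, \<open>card (S \<inter> V)\<close> is at
    most \<open>r\<close> and differs from \<open>r\<close>, so \<open>S\<close> has no edge inside
    \<open>V\<close>.\<close>
  have N2_V: "cov r N2 f = 0" if "f \<subseteq> V" for f
  proof (rule ccontr)
    assume "cov r N2 f \<noteq> 0"
    then obtain S where S: "S \<in># N2" "f \<subseteq> S" "card f = r"
      unfolding cov_eq_0_iff Kedges_def by blast
    then have "r \<le> card (S \<inter> V)"
      using that V(1) card_mono[of "S \<inter> V" f] by simp
    then show False using noV S(1) card2(2)[of S] by auto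
  qed
  have P2_V: "cov r P2 f = of_bool (f \<in> EL)" if "f \<subseteq> V" for f
  proof -
    have "\<phi> f = int (cov r P2 f) - int (cov r N2 f)" using R that unfolding realises_def by blast
    then show ?thesis using N2_V[OF that] by (cases "f \<in> EL") (simp_all add: \<phi>_def)
  qed
  have out: "cov r P2 f = cov r N2 f" "cov r P2 f \<le> 1" if "\<not> f \<subseteq> V" for f
    using R that unfolding realises_def by blast+
  define VA where "VA = V \<union> \<Union>(set_mset (P2 + N2))"
  \<comment> \<open>The negative cliques decompose the absorber. The positive ones cover the same
    edges that leave \<open>V\<close>, and exactly \<open>EL\<close> inside \<open>V\<close>, so
    they decompose \<open>EL \<union> EA\<close>.\<close>
  define EA where "EA = {f. 0 < cov r N2 f}"
  have in_VA: "Q \<subseteq> VA \<and> finite Q \<and> card Q = q" if "Q \<in># P2 + N2" for Q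
    using that card2(1)[OF that] finQ unfolding VA_def by blast
  have finVA: "finite VA" unfolding VA_def using V(1) card2(1) finQ by auto
  have "rgraph r VA EA"
    unfolding rgraph_def EA_def cov_pos_iff using finVA in_VA by (auto simp: Kedges_def)
  moreover have "Kqr_absorber q r VL EL VA EA"
    unfolding Kqr_absorber_def
  proof (intro conjI)
    show "VL \<subseteq> VA" using V(2) unfolding VA_def by blast
    then have VA: "VL \<union> VA = VA" by auto
    show "independent_in VL EA"
      unfolding independent_in_def EA_def using N2_V V(2) by force
    have le1: "cov r P2 f \<le> 1" "cov r N2 f \<le> 1" for f
      using P2_V[of f] N2_V[of f] out[of f] by (cases "f \<subseteq> V"; simp)+
    show "has_Kqr_decomposition q r VA EA"
      unfolding EA_def using in_VA le1 by (intro has_decomposition_if_cov_le_1) auto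
    have "EL \<union> EA = {f. 0 < cov r P2 f}"
    proof (intro set_eqI)
      fix f
      show "f \<in> EL \<union> EA \<longleftrightarrow> f \<in> {f. 0 < cov r P2 f}"
      proof (cases "f \<subseteq> V")
        case True
        then show ?thesis using P2_V N2_V by (simp add: EA_def)
      next
        case False
        then have "f \<notin> EL" using EL V(2) by blast
        then show ?thesis using out[OF False] by (simp add: EA_def)
      qed
    qed
    then show "has_Kqr_decomposition q r (VL \<union> VA) (EL \<union> EA)"
      unfolding VA using in_VA le1 by (simp only:) (intro has_decomposition_if_cov_le_1; auto)
  qed
  ultimately show ?thesis by blast
qed

end
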